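(* Let $(W,P)$ be a Hermitian symmetric pair. There is a $\mathbb Z[q,q^{-1}]$-algebra homomorphism from the generalised Temperley–Lieb algebra $\mathrm{TL}_W(q)$ to the oriented Temperley–Lieb algebra $\mathrm{TL}_{(W,P)}(q)$ defined by $U_i\mapsto E_i$ for all $s_i\in S_W$.
   Context: **Pairs.** $(W,S_W)$ is a Coxeter system with length function $\ell$ and $(s_is_j)^{m_{i,j}}=1$; $P$ is a standard parabolic subgroup; ${}^PW$ is the set of minimal length representatives of the cosets $P\backslash W$. $(W,P)$ is a Hermitian symmetric pair: one of $(A_n,A_{k-1}\times A_{n-k})$ ($1\le k\le n$), $(D_n,A_{n-1})$, $(D_n,D_{n-1})$, $(B_n,B_{n-1})$, $(C_n,A_{n-1})$ ($n\ge 2$), $(E_6,D_5)$, $(E_7,E_6)$. In each case $P$ is generated by all simple reflections except one: node $k$ for $(A_n,A_{k-1}\times A_{n-k})$; the end node at the double bond for $(C_n,A_{n-1})$; the end node furthest from the double bond (resp. fork) for $(B_n,B_{n-1})$ (resp. $(D_n,D_{n-1})$); one of the two end nodes at the fork for $(D_n,A_{n-1})$; the end node of a longest arm in types $E$. In type $B_n$ the end node at the double bond is the short simple root and the others are long; in type $C_n$ it is long and the others are short. **Generalised Temperley–Lieb algebra.** $\mathrm{TL}_W(q)$ is the $\mathbb Z[q,q^{-1}]$-algebra generated by $\{U_i\mid s_i\in S_W\}$ subject to $U_i^2=(q+q^{-1})U_i$; $U_iU_j=U_jU_i$ if $m_{i,j}=2$; $U_iU_jU_i=U_i$ if $m_{i,j}=3$;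 $U_iU_jU_iU_j=2U_iU_j$ if $m_{i,j}=4$. **Oriented Temperley–Lieb algebra.** $\mathrm{TL}_{(W,P)}(q)$ is the unital associative $\mathbb Z[q,q^{-1}]$-algebra generated by $\mathsf 1_\lambda$ ($\lambda\in{}^PW$) and $E_i$ ($s_i\in S_W$) with relations: (i) $\sum_\lambda\mathsf 1_\lambda=1$, $\mathsf 1_\lambda\mathsf 1_\mu=\delta_{\lambda,\mu}\mathsf 1_\lambda$, $\mathsf 1_\lambda E_i\mathsf 1_\lambda=0$ if $\lambda s_i\notin{}^PW$, $\mathsf 1_\lambda E_i\mathsf 1_\mu=0$ if $\mu\notin\{\lambda,\lambda s_i\}$; (ii) $\mathsf 1_\mu E_i\mathsf 1_\lambda E_i\mathsf 1_\nu=q^{\ell(\lambda s_i)-\ell(\lambda)}\mathsf 1_\mu E_i\mathsf 1_\nu$ whenever $\lambda,\lambda s_i\in{}^PW$ and $\mu,\nu\in\{\lambda,\lambda s_i\}$; (iii) $E_iE_j=E_jE_i$ if $m_{i,j}=2$ and $E_iE_jE_i=E_i$ if $m_{i,j}=3$; (iv) if $m_{i,j}=4$ and $\alpha_i$ is short, $\mathsf 1_\mu E_i\mathsf 1_\lambda E_j\mathsf 1_\lambda E_i\mathsf 1_\nu=\mathsf 1_\mu E_i\mathsf 1_\nu$ whenever $\lambda,\lambda s_i,\lambda s_j\in{}^PW$ and $\mu,\nu\in\{\lambda,\lambda s_i\}$. *)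

theory Defs
  imports "HOL-Algebra.QuotRing" "HOL-Algebra.Module" "HOL-Algebra.Generated_Groups"
    "HOL-Library.Poly_Mapping"
begin

section \<open>Algebras over the Laurent polynomials, by generators and relations\<close>

text \<open>
  The ring of integral Laurent polynomials in \<open>q\<close> is the monoid ring of the additive group of
  integers; the product on \<^typ>\<open>'a \<Rightarrow>\<^sub>0 'b\<close> is convolution.
\<close>

type_synonym laurent = "int \<Rightarrow>\<^sub>0 int"

definition q_pow :: "int \<Rightarrow> laurent" where
  "q_pow k = Poly_Mapping.single k 1"

text \<open>
  The free monoid, written additively, so that the convolution product of
  \<^theory>\<open>HOL-Library.Poly_Mapping\<close> is the product of the free associative algebra.
\<close>

datatype 'g fmon = Fmon (letters: "'g list")

instantiation fmon :: (type) monoid_add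
begin

definition zero_fmon :: "'a fmon" where
  "zero_fmon = Fmon []"

definition plus_fmon :: "'a fmon \<Rightarrow> 'a fmon \<Rightarrow> 'a fmon" where
  "plus_fmon u v = Fmon (letters u @ letters v)"

instance
  by standard (auto simp: zero_fmon_def plus_fmon_def)

end

type_synonym 'g ncpoly = "'g fmon \<Rightarrow>\<^sub>0 laurent"

definition gen :: "'g \<Rightarrow> 'g ncpoly" where
  "gen x = Poly_Mapping.single (Fmon [x]) 1"

definition scale :: "laurent \<Rightarrow> 'g ncpoly \<Rightarrow> 'g ncpoly" where
  "scale c f = Poly_Mapping.single 0 c * f"

definition free_algebra :: "'g set \<Rightarrow> (laurent, 'g ncpoly) module" where
  "free_algebra X =
     \<lparr>carrier = {f. \<forall>w\<in>Poly_Mapping.keys f. set (letters w) \<subseteq> X},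
      monoid.mult = (*), one = 1, ring.zero = 0, add = (+), smult = scale\<rparr>"

text \<open>\<^const>\<open>FactRing\<close> forgets the scalar action, which is put back on the quotient.\<close>

definition quotient_algebra ::
    "('r, 'a) module \<Rightarrow> 'a set \<Rightarrow> ('r, 'a set) module" where
  "quotient_algebra A J =
     ring.extend (A Quot J)
       (module.fields (\<lambda>c K. \<Union>x\<in>K. J +>\<^bsub>A\<^esub> (c \<odot>\<^bsub>A\<^esub> x)))"

text \<open>
  The unital associative algebra generated by \<open>X\<close> subject to \<open>l = r\<close> for all \<open>(l, r) \<in> R\<close>.
  Ideals in \<^theory>\<open>HOL-Algebra.Ideal\<close> are two-sided.
\<close>

definition relation_ideal :: "'g set \<Rightarrow> ('g ncpoly \<times> 'g ncpoly) set \<Rightarrow> 'g ncpoly set" where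
  "relation_ideal X R = genideal (free_algebra X) {l - r | l r. (l, r) \<in> R}"

definition presented_algebra ::
    "'g set \<Rightarrow> ('g ncpoly \<times> 'g ncpoly) set \<Rightarrow> (laurent, 'g ncpoly set) module" where
  "presented_algebra X R = quotient_algebra (free_algebra X) (relation_ideal X R)"

definition presented_gen ::
    "'g set \<Rightarrow> ('g ncpoly \<times> 'g ncpoly) set \<Rightarrow> 'g \<Rightarrow> 'g ncpoly set" where
  "presented_gen X R x = relation_ideal X R +>\<^bsub>free_algebra X\<^esub> gen x"

definition algebra_hom :: "('r, 'a) module \<Rightarrow> ('r, 'b) module \<Rightarrow> ('a \<Rightarrow> 'b) set" where
  "algebra_hom A B =
     {h \<in> ring_hom A B. \<forall>c. \<forall>x\<in>carrier A. h (c \<odot>\<^bsub>A\<^esub> x) = c \<odot>\<^bsub>B\<^esub> h x}"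


section \<open>Coxeter systems\<close>

text \<open>
  Equality of words modulo \<open>(s\<^sub>i s\<^sub>j)\<^bsup>m i j\<^esup> = 1\<close>. As \<open>m i i = 1\<close> makes every generator an involution,
  this monoid congruence presents the Coxeter group; \<open>m i j = 0\<close> encodes the absence of a relation.
\<close>

inductive coxeter_cong :: "nat set \<Rightarrow> (nat \<Rightarrow> nat \<Rightarrow> nat) \<Rightarrow> nat list \<Rightarrow> nat list \<Rightarrow> bool"
  for I m where
  cong_rel: "\<lbrakk>i \<in> I; j \<in> I; u \<in> lists I; v \<in> lists I\<rbrakk>
     \<Longrightarrow> coxeter_cong I m (u @ concat (replicate (m i j) [i, j]) @ v) (u @ v)"
| cong_refl: "u \<in> lists I \<Longrightarrow> coxeter_cong I m u u"
| cong_sym: "coxeter_cong I m u v \<Longrightarrow> coxeter_cong I m v u"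
| cong_trans: "\<lbrakk>coxeter_cong I m u v; coxeter_cong I m v w\<rbrakk> \<Longrightarrow> coxeter_cong I m u w"

definition word_prod :: "('w, 'b) monoid_scheme \<Rightarrow> (nat \<Rightarrow> 'w) \<Rightarrow> nat list \<Rightarrow> 'w" where
  "word_prod W s u = foldr (\<lambda>i x. s i \<otimes>\<^bsub>W\<^esub> x) u \<one>\<^bsub>W\<^esub>"

text \<open>
  \<open>W\<close> is the group presented by the generators \<open>s i\<close>, \<open>i \<in> I\<close>, and the Coxeter relations: it is
  generated by them, and two words have the same value only if the relations force it.
\<close>

locale coxeter_system = group W for W (structure) +
  fixes I :: "nat set" and s :: "nat \<Rightarrow> 'a" and m :: "nat \<Rightarrow> nat \<Rightarrow> nat"
  assumes m_diag: "i \<in> I \<Longrightarrow> m i i = 1"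
    and m_sym: "\<lbrakk>i \<in> I; j \<in> I\<rbrakk> \<Longrightarrow> m i j = m j i"
    and m_off_diag: "\<lbrakk>i \<in> I; j \<in> I; i \<noteq> j\<rbrakk> \<Longrightarrow> m i j \<noteq> 1"
    and s_closed: "i \<in> I \<Longrightarrow> s i \<in> carrier W"
    and generated: "carrier W = word_prod W s ` lists I"
    and presented: "\<lbrakk>u \<in> lists I; v \<in> lists I\<rbrakk>
          \<Longrightarrow> word_prod W s u = word_prod W s v \<longleftrightarrow> coxeter_cong I m u v"

definition cox_length :: "('w, 'b) monoid_scheme \<Rightarrow> nat set \<Rightarrow> (nat \<Rightarrow> 'w) \<Rightarrow> 'w \<Rightarrow> nat" where
  "cox_length W I s w = (LEAST n. \<exists>u\<in>lists I. length u = n \<and> word_prod W s u = w)"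

definition parabolic :: "('w, 'b) monoid_scheme \<Rightarrow> (nat \<Rightarrow> 'w) \<Rightarrow> nat set \<Rightarrow> 'w set" where
  "parabolic W s J = generate W (s ` J)"

text \<open>Minimal length representatives of the cosets \<open>P w\<close>, where \<open>P\<close> is generated by \<open>J \<subseteq> I\<close>.\<close>

definition min_coset_reps ::
    "('w, 'b) monoid_scheme \<Rightarrow> nat set \<Rightarrow> (nat \<Rightarrow> 'w) \<Rightarrow> nat set \<Rightarrow> 'w set" where
  "min_coset_reps W I s J =
     {w \<in> carrier W. \<forall>x \<in> parabolic W s J #>\<^bsub>W\<^esub> w. cox_length W I s w \<le> cox_length W I s x}"


section \<open>Hermitian symmetric pairs\<close>

datatype cartan_type = TypeA nat | TypeB nat | TypeC nat | TypeD nat | TypeE6 | TypeE7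

text \<open>
  Nodes are numbered from 1 as in Bourbaki. The double bond in types \<open>B\<close> and \<open>C\<close> joins \<open>n - 1\<close> and
  \<open>n\<close>; the fork in type \<open>D\<close> is at \<open>n - 2\<close>, with end nodes \<open>n - 1\<close> and \<open>n\<close>; the branch node in types
  \<open>E\<close> is \<open>4\<close>, with arms \<open>2\<close>, \<open>3 - 1\<close> and \<open>5 - 6 (- 7)\<close>.
\<close>

fun nodes :: "cartan_type \<Rightarrow> nat set" where
  "nodes (TypeA n) = {1..n}"
| "nodes (TypeB n) = {1..n}"
| "nodes (TypeC n) = {1..n}"
| "nodes (TypeD n) = {1..n}"
| "nodes TypeE6 = {1..6}"
| "nodes TypeE7 = {1..7}"

fun edges :: "cartan_type \<Rightarrow> nat set set" where
  "edges (TypeA n) = {{i, i + 1} | i. 1 \<le> i \<and> i < n}"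
| "edges (TypeB n) = {{i, i + 1} | i. 1 \<le> i \<and> i < n}"
| "edges (TypeC n) = {{i, i + 1} | i. 1 \<le> i \<and> i < n}"
| "edges (TypeD n) = {{i, i + 1} | i. 1 \<le> i \<and> i < n - 1} \<union> {{n - 2, n}}"
| "edges TypeE6 = {{1, 3}, {3, 4}, {4, 5}, {5, 6}, {2, 4}}"
| "edges TypeE7 = {{1, 3}, {3, 4}, {4, 5}, {5, 6}, {6, 7}, {2, 4}}"

fun double_edges :: "cartan_type \<Rightarrow> nat set set" where
  "double_edges (TypeB n) = {{n - 1, n}}"
| "double_edges (TypeC n) = {{n - 1, n}}"
| "double_edges _ = {}"

definition coxeter_matrix :: "cartan_type \<Rightarrow> nat \<Rightarrow> nat \<Rightarrow> nat" where
  "coxeter_matrix T i j =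
     (if i = j then 1
      else if {i, j} \<in> double_edges T then 4
      else if {i, j} \<in> edges T then 3
      else 2)"

text \<open>
  Root lengths matter only at a double bond; in the simply laced types no root is called short.
\<close>

fun short_root :: "cartan_type \<Rightarrow> nat \<Rightarrow> bool" where
  "short_root (TypeB n) i \<longleftrightarrow> i = n"
| "short_root (TypeC n) i \<longleftrightarrow> i \<noteq> n"
| "short_root _ i \<longleftrightarrow> False"

text \<open>
  \<open>hermitian_pair T k\<close>: \<open>W\<close> has type \<open>T\<close> and \<open>P\<close> is generated by all simple reflections except
  \<open>s\<^sub>k\<close>. In type \<open>D\<^sub>n\<close>, \<open>k = 1\<close> gives \<open>P\<close> of type \<open>D\<^bsub>n-1\<^esub>\<close> and \<open>k = n - 1, n\<close> give type \<open>A\<^bsub>n-1\<^esub>\<close>.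
\<close>

fun hermitian_pair :: "cartan_type \<Rightarrow> nat \<Rightarrow> bool" where
  "hermitian_pair (TypeA n) k \<longleftrightarrow> 1 \<le> k \<and> k \<le> n"
| "hermitian_pair (TypeB n) k \<longleftrightarrow> 2 \<le> n \<and> k = 1"
| "hermitian_pair (TypeC n) k \<longleftrightarrow> 2 \<le> n \<and> k = n"
| "hermitian_pair (TypeD n) k \<longleftrightarrow> 4 \<le> n \<and> k \<in> {1, n - 1, n}"
| "hermitian_pair TypeE6 k \<longleftrightarrow> k \<in> {1, 6}"
| "hermitian_pair TypeE7 k \<longleftrightarrow> k = 7"


section \<open>The generalised Temperley--Lieb algebra\<close>

definition TL_relations :: "nat set \<Rightarrow> (nat \<Rightarrow> nat \<Rightarrow> nat) \<Rightarrow> (nat ncpoly \<times> nat ncpoly) set" where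
  "TL_relations I m =
     {(gen i * gen i, scale (q_pow 1 + q_pow (- 1)) (gen i)) | i. i \<in> I}
   \<union> {(gen i * gen j, gen j * gen i) | i j. i \<in> I \<and> j \<in> I \<and> m i j = 2}
   \<union> {(gen i * gen j * gen i, gen i) | i j. i \<in> I \<and> j \<in> I \<and> m i j = 3}
   \<union> {(gen i * gen j * gen i * gen j, scale 2 (gen i * gen j)) | i j.
        i \<in> I \<and> j \<in> I \<and> m i j = 4}"

definition TL :: "cartan_type \<Rightarrow> (laurent, nat ncpoly set) module" where
  "TL T = presented_algebra (nodes T) (TL_relations (nodes T) (coxeter_matrix T))"

definition TL_U :: "cartan_type \<Rightarrow> nat \<Rightarrow> nat ncpoly set" where
  "TL_U T i = presented_gen (nodes T) (TL_relations (nodes T) (coxeter_matrix T)) i"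


section \<open>The oriented Temperley--Lieb algebra\<close>

datatype 'w oriented_gen = Idempotent 'w | Edge nat

abbreviation idem :: "'w \<Rightarrow> 'w oriented_gen ncpoly" where
  "idem w \<equiv> gen (Idempotent w)"

abbreviation edge :: "nat \<Rightarrow> 'w oriented_gen ncpoly" where
  "edge i \<equiv> gen (Edge i)"

definition oriented_gens :: "nat set \<Rightarrow> 'w set \<Rightarrow> 'w oriented_gen set" where
  "oriented_gens I D = Idempotent ` D \<union> Edge ` I"

text \<open>
  Here \<open>D\<close> is the set of minimal coset representatives, \<open>l\<close> the length function, and \<open>act w i\<close>
  the product \<open>w s\<^sub>i\<close>. In the intended instances \<open>W\<close> is finite, hence so is the sum over \<open>D\<close>.
\<close>

definition oriented_TL_relations ::
    "nat set \<Rightarrow> (nat \<Rightarrow> nat \<Rightarrow> nat) \<Rightarrow> (nat \<Rightarrow> bool) \<Rightarrow> 'w set \<Rightarrow> ('w \<Rightarrow> nat) \<Rightarrow> ('w \<Rightarrow> nat \<Rightarrow> 'w)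
     \<Rightarrow> ('w oriented_gen ncpoly \<times> 'w oriented_gen ncpoly) set" where
  "oriented_TL_relations I m short D l act =
     {(\<Sum>x\<in>D. idem x, 1)}
   \<union> {(idem x * idem y, if x = y then idem x else 0) | x y. x \<in> D \<and> y \<in> D}
   \<union> {(idem x * edge i * idem x, 0) | x i. x \<in> D \<and> i \<in> I \<and> act x i \<notin> D}
   \<union> {(idem x * edge i * idem y, 0) | x y i.
        x \<in> D \<and> y \<in> D \<and> i \<in> I \<and> y \<notin> {x, act x i}}
   \<union> {(idem y * edge i * idem x * edge i * idem z,
        scale (q_pow (int (l (act x i)) - int (l x))) (idem y * edge i * idem z)) | x y z i.
        i \<in> I \<and> x \<in> D \<and> act x i \<in> D \<and> y \<in> {x, act x i} \<and> z \<in> {x, act x i}}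
   \<union> {(edge i * edge j, edge j * edge i) | i j. i \<in> I \<and> j \<in> I \<and> m i j = 2}
   \<union> {(edge i * edge j * edge i, edge i) | i j. i \<in> I \<and> j \<in> I \<and> m i j = 3}
   \<union> {(idem y * edge i * idem x * edge j * idem x * edge i * idem z,
        idem y * edge i * idem z) | x y z i j.
        i \<in> I \<and> j \<in> I \<and> m i j = 4 \<and> short i \<and>
        x \<in> D \<and> act x i \<in> D \<and> act x j \<in> D \<and> y \<in> {x, act x i} \<and> z \<in> {x, act x i}}"

definition oriented_reps ::
    "('w, 'b) monoid_scheme \<Rightarrow> (nat \<Rightarrow> 'w) \<Rightarrow> cartan_type \<Rightarrow> nat \<Rightarrow> 'w set" where
  "oriented_reps W s T k = min_coset_reps W (nodes T) s (nodes T - {k})"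

definition oriented_TL_rels ::
    "('w, 'b) monoid_scheme \<Rightarrow> (nat \<Rightarrow> 'w) \<Rightarrow> cartan_type \<Rightarrow> nat
     \<Rightarrow> ('w oriented_gen ncpoly \<times> 'w oriented_gen ncpoly) set" where
  "oriented_TL_rels W s T k =
     oriented_TL_relations (nodes T) (coxeter_matrix T) (short_root T) (oriented_reps W s T k)
       (cox_length W (nodes T) s) (\<lambda>w i. w \<otimes>\<^bsub>W\<^esub> s i)"

definition oriented_TL ::
    "('w, 'b) monoid_scheme \<Rightarrow> (nat \<Rightarrow> 'w) \<Rightarrow> cartan_type \<Rightarrow> nat
     \<Rightarrow> (laurent, 'w oriented_gen ncpoly set) module" where
  "oriented_TL W s T k =
     presented_algebra (oriented_gens (nodes T) (oriented_reps W s T k)) (oriented_TL_rels W s T k)"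

definition oriented_TL_E ::
    "('w, 'b) monoid_scheme \<Rightarrow> (nat \<Rightarrow> 'w) \<Rightarrow> cartan_type \<Rightarrow> nat \<Rightarrow> nat
     \<Rightarrow> 'w oriented_gen ncpoly set" where
  "oriented_TL_E W s T k i =
     presented_gen (oriented_gens (nodes T) (oriented_reps W s T k)) (oriented_TL_rels W s T k)
       (Edge i)"

end

theory Submission
  imports Defs
begin

text \<open>
  A homomorphism out of an algebra given by generators and relations is a choice of images that
  satisfy the relations, so the content is that the \<open>E\<^sub>i\<close> satisfy the relations of the \<open>U\<^sub>i\<close>. Two of
  these, for \<open>m\<^sub>i\<^sub>j = 2\<close> and \<open>m\<^sub>i\<^sub>j = 3\<close>, are imposed. The quadratic and the quartic one are checked on
  Peirce components: as \<open>1 = \<Sum>\<^sub>\<lambda> 1\<^sub>\<lambda>\<close>, it suffices to compare \<open>1\<^sub>\<lambda> a 1\<^sub>\<mu>\<close> with \<open>1\<^sub>\<lambda> b 1\<^sub>\<mu>\<close>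
  (\<open>cong_peirce\<close>), and idempotents may be inserted between the factors of \<open>a\<close>.

  Quadratic relation. A component of \<open>E\<^sub>i\<close> can be nonzero only inside a pair \<open>{\<lambda>, \<lambda>s\<^sub>i}\<close> of minimal coset
  representatives. Inserting the two idempotents of the pair in the middle of \<open>E\<^sub>i E\<^sub>i\<close> contributes
  \<open>q\<^bsup>d\<^esup>\<close> and \<open>q\<^bsup>-d\<^esup>\<close> with \<open>d = \<ell>(\<lambda>s\<^sub>i) - \<ell>(\<lambda>) = \<plusminus>1\<close>.

  Quartic relation. Let \<open>m\<^sub>i\<^sub>j = 4\<close> with \<open>\<alpha>\<^sub>i\<close> short; this happens only in types \<open>B\<close> and \<open>C\<close>. It is
  enough that \<open>E\<^sub>i E\<^sub>j E\<^sub>i = 2 E\<^sub>i\<close>, which follows from the defining relation at the double bond once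
  one knows (\<open>double_bond_min_coset_reps\<close>): if \<open>\<lambda>\<close> and \<open>\<lambda>s\<^sub>i\<close> are minimal representatives,
  then so is \<open>\<lambda>s\<^sub>j\<close>, but \<open>\<lambda>s\<^sub>js\<^sub>i\<close> is not. The first part makes the relation applicable; the second
  kills the terms in which \<open>E\<^sub>j\<close> changes the idempotent, and the two elements of the pair give the
  factor \<open>2\<close>.

  This combinatorial fact is read off from the orbit of the fundamental weight \<open>\<omega>\<^sub>k\<close> under the right
  action of \<open>W\<close>. For a dominant weight \<open>x\<close>, if \<open>\<ell>(ws\<^sub>i) > \<ell>(w)\<close>, then the \<open>i\<close>-th coordinate of \<open>xw\<close>
  is nonnegative (\<open>weight_nonneg_of_ascent\<close>). Hence \<open>P\<close> is the stabiliser of \<open>\<omega>\<^sub>k\<close>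
  (\<open>weight_stabilizer\<close>), and for a minimal representative \<open>w\<close> the element \<open>ws\<^sub>i\<close> is again minimal
  if and only if the \<open>i\<close>-th coordinate of \<open>\<omega>\<^sub>kw\<close> does not vanish (\<open>mult_s_min_coset_rep_iff\<close>).
  The orbit of \<open>\<omega>\<^sub>1\<close> consists of the vectors \<open>\<plusminus>e\<^sub>a\<close> (type \<open>B\<close>), that of \<open>\<omega>\<^sub>n\<close>, up to
  scaling, of the sign vectors (type \<open>C\<close>), where the claim is visible.
\<close>

section \<open>Lengths in a Coxeter group\<close>

context coxeter_system
begin

abbreviation len :: "'a \<Rightarrow> nat" where
  "len \<equiv> cox_length W I s"

lemma word_prod_closed: "u \<in> lists I \<Longrightarrow> word_prod W s u \<in> carrier W"
  by (induction u) (auto simp: word_prod_def s_closed)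

lemma word_prod_append:
  "u \<in> lists I \<Longrightarrow> v \<in> lists I \<Longrightarrow>
   word_prod W s (u @ v) = word_prod W s u \<otimes> word_prod W s v"
proof (induction u)
  case Nil
  then show ?case using word_prod_closed[of v] by (simp add: word_prod_def)
next
  case (Cons a u)
  then show ?case
    using word_prod_closed[of u] word_prod_closed[of v] s_closed[of a]
    by (simp add: word_prod_def m_assoc)
qed

lemma word_prod_Nil: "word_prod W s [] = \<one>"
  by (simp add: word_prod_def)

lemma word_prod_snoc:
  "u \<in> lists I \<Longrightarrow> i \<in> I \<Longrightarrow> word_prod W s (u @ [i]) = word_prod W s u \<otimes> s i"
  using word_prod_append[of u "[i]"] s_closed[of i] by (simp add: word_prod_def)

lemma braid_relation:
  assumes "i \<in> I" "j \<in> I"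
  shows "word_prod W s (concat (replicate (m i j) [i, j])) = \<one>"
proof -
  have "coxeter_cong I m ([] @ concat (replicate (m i j) [i, j]) @ []) ([] @ [])"
    using assms by (intro coxeter_cong.cong_rel) auto
  moreover have "concat (replicate (m i j) [i, j]) \<in> lists I"
    using assms by (auto simp: in_lists_conv_set)
  ultimately show ?thesis
    using presented[of "concat (replicate (m i j) [i, j])" "[]"] by (simp add: word_prod_Nil)
qed

lemma s_square: "i \<in> I \<Longrightarrow> s i \<otimes> s i = \<one>"
  using braid_relation[of i i] by (simp add: m_diag word_prod_def s_closed)

lemma s_cancel: "i \<in> I \<Longrightarrow> w \<in> carrier W \<Longrightarrow> w \<otimes> s i \<otimes> s i = w"
  by (simp add: m_assoc s_closed s_square)

lemma inv_s: "i \<in> I \<Longrightarrow> inv (s i) = s i"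
  using s_square[of i] s_closed[of i] by (simp add: inv_equality)

lemma cong_length_parity:
  "coxeter_cong I m u v \<Longrightarrow> even (length u) \<longleftrightarrow> even (length v)"
  by (induction rule: coxeter_cong.induct) (auto simp: length_concat sum_list_replicate)

lemma ex_word: "w \<in> carrier W \<Longrightarrow> \<exists>u\<in>lists I. word_prod W s u = w"
  using generated by auto

lemma ex_reduced_word:
  assumes "w \<in> carrier W"
  obtains u where "u \<in> lists I" "length u = len w" "word_prod W s u = w"
proof -
  obtain u where "u \<in> lists I" "word_prod W s u = w"
    using ex_word[OF assms] by auto
  then have "\<exists>n. \<exists>u\<in>lists I. length u = n \<and> word_prod W s u = w" by blast
  from LeastI_ex[OF this] show thesis
    using that unfolding cox_length_def by blast
qed

lemma len_word_prod_le: "u \<in> lists I \<Longrightarrow> len (word_prod W s u) \<le> length u"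
  unfolding cox_length_def by (rule Least_le) blast

lemma len_eq_0: "w \<in> carrier W \<Longrightarrow> len w = 0 \<Longrightarrow> w = \<one>"
  by (metis ex_reduced_word length_0_conv word_prod_Nil)

lemma len_mult_s_le:
  assumes "w \<in> carrier W" "i \<in> I"
  shows "len (w \<otimes> s i) \<le> Suc (len w)"
proof -
  obtain u where u: "u \<in> lists I" "length u = len w" "word_prod W s u = w"
    using ex_reduced_word assms by blast
  then have "word_prod W s (u @ [i]) = w \<otimes> s i"
    using assms by (simp add: word_prod_snoc)
  moreover have "u @ [i] \<in> lists I" using u(1) assms(2) by auto
  ultimately show ?thesis
    using len_word_prod_le[of "u @ [i]"] u(2) by simp
qed

text \<open>Every Coxeter relation has even length, so multiplying by a generator changes the parity.\<close>

lemma len_mult_s_parity: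
  assumes "w \<in> carrier W" "i \<in> I"
  shows "even (len (w \<otimes> s i)) \<longleftrightarrow> odd (len w)"
proof -
  obtain u where u: "u \<in> lists I" "length u = len w" "word_prod W s u = w"
    using ex_reduced_word assms by blast
  have "w \<otimes> s i \<in> carrier W" using assms s_closed by simp
  then obtain v where v: "v \<in> lists I" "length v = len (w \<otimes> s i)" "word_prod W s v = w \<otimes> s i"
    using ex_reduced_word by blast
  have ui: "u @ [i] \<in> lists I" using u(1) assms(2) by auto
  have "word_prod W s (u @ [i]) = word_prod W s v"
    using u v assms by (simp add: word_prod_snoc)
  then have "coxeter_cong I m (u @ [i]) v"
    using presented ui v(1) by blast
  from cong_length_parity[OF this] show ?thesis
    using u(2) v(2) by simp
qed

lemma len_mult_s:
  assumes "w \<in> carrier W" "i \<in> I"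
  shows "len (w \<otimes> s i) = Suc (len w) \<or> len w = Suc (len (w \<otimes> s i))"
proof -
  have c: "w \<otimes> s i \<in> carrier W" using assms s_closed by simp
  have "len w \<le> Suc (len (w \<otimes> s i))"
    using len_mult_s_le[OF c assms(2)] s_cancel[OF assms(2,1)] by simp
  moreover have "len (w \<otimes> s i) \<noteq> len w"
    using len_mult_s_parity[OF assms] by auto
  ultimately show ?thesis
    using len_mult_s_le[OF assms] by linarith
qed

lemma ex_right_descent:
  assumes "w \<in> carrier W" "len w \<noteq> 0"
  obtains i where "i \<in> I" "len w = Suc (len (w \<otimes> s i))"
proof -
  obtain u where u: "u \<in> lists I" "length u = len w" "word_prod W s u = w"
    using ex_reduced_word assms by blast
  with assms(2) obtain v i where ui: "u = v @ [i]"
    by (cases u rule: rev_cases) auto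
  with u(1) have vi: "v \<in> lists I" "i \<in> I" by auto
  have w: "w = word_prod W s v \<otimes> s i"
    using u(3) ui vi by (simp add: word_prod_snoc)
  then have "w \<otimes> s i = word_prod W s v"
    using s_cancel[OF vi(2)] word_prod_closed[OF vi(1)] by simp
  then have "len (w \<otimes> s i) < len w"
    using len_word_prod_le[OF vi(1)] u(2) ui by simp
  then show thesis
    using that[OF vi(2)] len_mult_s[OF assms(1) vi(2)] by linarith
qed

lemma braid_moves:
  assumes "v \<in> carrier W" "i \<in> I" "j \<in> I"
  shows "m i j = 2 \<Longrightarrow> v \<otimes> s i \<otimes> s j = v \<otimes> s j \<otimes> s i"
    and "m i j = 3 \<Longrightarrow> v \<otimes> s i \<otimes> s j \<otimes> s i = v \<otimes> s j \<otimes> s i \<otimes> s j"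
    and "m i j = 4 \<Longrightarrow>
      v \<otimes> s i \<otimes> s j \<otimes> s i \<otimes> s j = v \<otimes> s j \<otimes> s i \<otimes> s j \<otimes> s i"
proof -
  note c = assms(1) s_closed[OF assms(2)] s_closed[OF assms(3)]
  note rel = braid_relation[OF assms(2,3)]
  {
    assume "m i j = 2"
    then have "v = v \<otimes> s i \<otimes> s j \<otimes> s i \<otimes> s j"
      using rel c by (simp add: word_prod_def numeral_eq_Suc m_assoc)
    \<comment> \<open>Half of the relation is moved to the other side by right multiplication.\<close>
    from arg_cong[OF this, of "\<lambda>v. v \<otimes> s j \<otimes> s i"]
    show "v \<otimes> s i \<otimes> s j = v \<otimes> s j \<otimes> s i"
      using c assms by (simp add: s_cancel)
  }
  {
    assume "m i j = 3"
    then have "v = v \<otimes> s i \<otimes> s j \<otimes> s i \<otimes> s j \<otimes> s i \<otimes> s j"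
      using rel c by (simp add: word_prod_def numeral_eq_Suc m_assoc)
    from arg_cong[OF this, of "\<lambda>v. v \<otimes> s j \<otimes> s i \<otimes> s j"]
    show "v \<otimes> s i \<otimes> s j \<otimes> s i = v \<otimes> s j \<otimes> s i \<otimes> s j"
      using c assms by (simp add: s_cancel)
  }
  {
    assume "m i j = 4"
    then have "v = v \<otimes> s i \<otimes> s j \<otimes> s i \<otimes> s j \<otimes> s i \<otimes> s j \<otimes> s i \<otimes> s j"
      using rel c by (simp add: word_prod_def numeral_eq_Suc m_assoc)
    from arg_cong[OF this, of "\<lambda>v. v \<otimes> s j \<otimes> s i \<otimes> s j \<otimes> s i"]
    show "v \<otimes> s i \<otimes> s j \<otimes> s i \<otimes> s j = v \<otimes> s j \<otimes> s i \<otimes> s j \<otimes> s i"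
      using c assms by (simp add: s_cancel)
  }
qed

lemma min_coset_reps_iff:
  "w \<in> min_coset_reps W I s J \<longleftrightarrow>
     w \<in> carrier W \<and> (\<forall>p\<in>parabolic W s J. len w \<le> len (p \<otimes> w))"
  by (auto simp: min_coset_reps_def r_coset_def)

lemma parabolic_closed: "J \<subseteq> I \<Longrightarrow> p \<in> parabolic W s J \<Longrightarrow> p \<in> carrier W"
  using generate_incl[of "s ` J"] s_closed unfolding parabolic_def by blast

end

section \<open>The action on weights\<close>

text \<open>
  Mozes's numbers game: a weight is recorded by its coordinates \<open>x j = \<langle>x, \<alpha>\<^sub>j\<^sup>\<or>\<rangle>\<close>, and firing node
  \<open>i\<close> applies the simple reflection \<open>x \<mapsto> x - \<langle>x, \<alpha>\<^sub>i\<^sup>\<or>\<rangle> \<alpha>\<^sub>i\<close>, where \<open>A i j = \<langle>\<alpha>\<^sub>i, \<alpha>\<^sub>j\<^sup>\<or>\<rangle>\<close>.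
\<close>

definition fire :: "(nat \<Rightarrow> nat \<Rightarrow> int) \<Rightarrow> nat \<Rightarrow> (nat \<Rightarrow> int) \<Rightarrow> nat \<Rightarrow> int" where
  "fire A i x = (\<lambda>j. x j - x i * A i j)"

text \<open>
  The bonds are those of finite crystallographic types other than \<open>G\<^sub>2\<close>, so that all dihedral
  computations take place in groups of order at most 8.
\<close>

locale cartan_coxeter_system = coxeter_system W I s m
  for W (structure) and I :: "nat set" and s :: "nat \<Rightarrow> 'a" and m :: "nat \<Rightarrow> nat \<Rightarrow> nat" +
  fixes A :: "nat \<Rightarrow> nat \<Rightarrow> int"
  assumes diag: "i \<in> I \<Longrightarrow> A i i = 2"
    and off_diag: "\<lbrakk>i \<in> I; j \<in> I; i \<noteq> j\<rbrakk> \<Longrightarrow>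
      m i j = 2 \<and> A i j = 0 \<and> A j i = 0 \<or>
      m i j = 3 \<and> A i j = -1 \<and> A j i = -1 \<or>
      m i j = 4 \<and> A i j = -1 \<and> A j i = -2 \<or>
      m i j = 4 \<and> A i j = -2 \<and> A j i = -1"
begin

abbreviation fire_word :: "(nat \<Rightarrow> int) \<Rightarrow> nat list \<Rightarrow> nat \<Rightarrow> int" where
  "fire_word \<equiv> foldl (\<lambda>x i. fire A i x)"

lemma fire_fire: "i \<in> I \<Longrightarrow> fire A i (fire A i x) = x"
  by (auto simp: fire_def fun_eq_iff diag algebra_simps)

lemma fire_word_braid:
  assumes "i \<in> I" "j \<in> I"
  shows "fire_word x (concat (replicate (m i j) [i, j])) = x"
proof (cases "i = j")
  case True
  then show ?thesis using assms by (simp add: m_diag fire_fire)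
next
  case False
  from off_diag[OF assms False] show ?thesis
    using diag[OF assms(1)] diag[OF assms(2)]
    by (elim disjE conjE)
       (simp_all add: numeral_eq_Suc fire_def fun_eq_iff algebra_simps)
qed

lemma fire_word_cong: "coxeter_cong I m u v \<Longrightarrow> fire_word x u = fire_word x v"
  by (induction arbitrary: x rule: coxeter_cong.induct) (simp_all add: fire_word_braid)

text \<open>
  By \<open>fire_word_cong\<close>, firing the letters of a word depends only on the value of the word in \<open>W\<close>,
  so any word representing \<open>w\<close> may be chosen.
\<close>

definition weight_act :: "(nat \<Rightarrow> int) \<Rightarrow> 'a \<Rightarrow> nat \<Rightarrow> int" where
  "weight_act x w = fire_word x (SOME u. u \<in> lists I \<and> word_prod W s u = w)"

lemma weight_act_word:
  assumes "u \<in> lists I"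
  shows "weight_act x (word_prod W s u) = fire_word x u"
proof -
  let ?v = "SOME v. v \<in> lists I \<and> word_prod W s v = word_prod W s u"
  have "?v \<in> lists I \<and> word_prod W s ?v = word_prod W s u"
    by (rule someI[of _ u]) (simp add: assms)
  then have "coxeter_cong I m ?v u" using presented assms by blast
  then show ?thesis unfolding weight_act_def by (rule fire_word_cong)
qed

lemma weight_act_one: "weight_act x \<one> = x"
  using weight_act_word[of "[]"] by (simp add: word_prod_Nil)

lemma weight_act_mult:
  assumes "g \<in> carrier W" "h \<in> carrier W"
  shows "weight_act x (g \<otimes> h) = weight_act (weight_act x g) h"
proof -
  obtain u v where uv: "u \<in> lists I" "v \<in> lists I" "g = word_prod W s u" "h = word_prod W s v"
    using ex_word assms by metis
  have "u @ v \<in> lists I" using uv by auto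
  from weight_act_word[OF this] show ?thesis
    using uv by (simp add: weight_act_word word_prod_append)
qed

lemma weight_act_s: "i \<in> I \<Longrightarrow> weight_act x (s i) = fire A i x"
  using weight_act_word[of "[i]"] by (simp add: word_prod_def s_closed)

lemma weight_act_mult_s:
  "w \<in> carrier W \<Longrightarrow> i \<in> I \<Longrightarrow> weight_act x (w \<otimes> s i) = fire A i (weight_act x w)"
  by (simp add: weight_act_mult s_closed weight_act_s)

lemma weight_act_mult_s_self:
  "w \<in> carrier W \<Longrightarrow> i \<in> I \<Longrightarrow> weight_act x (w \<otimes> s i) i = - weight_act x w i"
  by (simp add: weight_act_mult_s fire_def diag)

text \<open>
  Equivalent to the positivity of the root \<open>w \<alpha>\<^sub>i\<close>. The proof is the usual reduction to rank two: a right
  descent \<open>t \<noteq> i\<close> of \<open>w\<close> is removed, then letters \<open>i\<close> and \<open>t\<close> in turn as long as the length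
  drops. A braid relation would turn too long a tail into one ending in \<open>i\<close>, against \<open>\<ell>(ws\<^sub>i) > \<ell>(w)\<close>,
  so the tail has fewer than \<open>m\<^sub>i\<^sub>t\<close> letters. The remaining prefix has neither descent, hence
  nonnegative coordinates at \<open>i\<close> and \<open>t\<close> by induction, and playing the tail keeps the coordinate at \<open>i\<close>
  nonnegative.
\<close>

lemma weight_nonneg_of_ascent:
  assumes dom: "\<And>i. i \<in> I \<Longrightarrow> x i \<ge> 0"
    and "w \<in> carrier W" "i \<in> I" "len w < len (w \<otimes> s i)"
  shows "weight_act x w i \<ge> 0"
  using assms(2-4)
proof (induction "len w" arbitrary: w i rule: less_induct)
  case less
  show ?case
  proof (cases "len w = 0")
    case True
    then show ?thesis using len_eq_0 less.prems dom weight_act_one by metis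
  next
    case False
    then obtain t where t: "t \<in> I" and lt: "len w = Suc (len (w \<otimes> s t))"
      using ex_right_descent less.prems by blast
    have it: "i \<noteq> t" using lt less.prems(3) by auto
    note i = less.prems(2)
    note cl = less.prems(1) s_closed[OF i] s_closed[OF t]
    let ?a = "A i t" and ?b = "A t i"
    define v1 where "v1 = w \<otimes> s t"
    define v2 where "v2 = v1 \<otimes> s i"
    define v3 where "v3 = v2 \<otimes> s t"
    define v4 where "v4 = v3 \<otimes> s i"
    have c: "v1 \<in> carrier W" "v2 \<in> carrier W" "v3 \<in> carrier W" "v4 \<in> carrier W"
      using cl by (simp_all add: v1_def v2_def v3_def v4_def)
    have w1: "w = v1 \<otimes> s t" and w2: "v1 = v2 \<otimes> s i" and w3: "v2 = v3 \<otimes> s t"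
      and w4: "v3 = v4 \<otimes> s i"
      using c cl i t by (simp_all add: v1_def v2_def v3_def v4_def s_cancel)
    have len1: "len w = Suc (len v1)" using lt by (simp add: v1_def)
    have IH: "weight_act x v i \<ge> 0 \<and> weight_act x v t \<ge> 0"
      if "v \<in> carrier W" "len v < len w" "len v < len (v \<otimes> s i)" "len v < len (v \<otimes> s t)" for v
      using less.hyps that i t by blast
    have step: "weight_act x (v \<otimes> s t) i = weight_act x v i - weight_act x v t * ?b"
      "weight_act x (v \<otimes> s i) t = weight_act x v t - weight_act x v i * ?a"
      if "v \<in> carrier W" for v
      using that i t by (simp_all add: weight_act_mult_s fire_def)
    have neg: "weight_act x (v \<otimes> s t) t = - weight_act x v t"
      "weight_act x (v \<otimes> s i) i = - weight_act x v i"
      if "v \<in> carrier W" for v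
      using that i t by (simp_all add: weight_act_mult_s_self)
    have le: "len (v \<otimes> s i) \<le> Suc (len v)" "len (v \<otimes> s t) \<le> Suc (len v)"
      if "v \<in> carrier W" for v
      using that i t by (simp_all add: len_mult_s_le)
    have desc: "len v = Suc (len (v \<otimes> s j)) \<or> len v < len (v \<otimes> s j)"
      if "v \<in> carrier W" "j \<in> I" for v j
      using len_mult_s[OF that] by auto
    have b: "?b \<le> 0" using off_diag[OF i t it] by auto
    \<comment> \<open>The tail cannot be as long as the bond permits: it would end in \<open>i\<close> after a braid move.\<close>
    have not2: "m i t \<noteq> 2" if "len v1 = Suc (len v2)"
    proof
      assume "m i t = 2"
      then have "w = v2 \<otimes> s t \<otimes> s i"
        using braid_moves(1)[OF c(2) i t] w1 w2 by metis
      then have "w \<otimes> s i = v2 \<otimes> s t" using c cl i t by (simp add: s_cancel)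
      then show False using le(2)[OF c(2)] that len1 less.prems(3) by simp
    qed
    have not3: "m i t \<noteq> 3" if "len v1 = Suc (len v2)" "len v2 = Suc (len v3)"
    proof
      assume "m i t = 3"
      then have "w = v3 \<otimes> s i \<otimes> s t \<otimes> s i"
        using braid_moves(2)[OF c(3) i t] w1 w2 w3 by metis
      then have e: "w \<otimes> s i = v3 \<otimes> s i \<otimes> s t" using c cl i t by (simp add: s_cancel)
      have "v3 \<otimes> s i \<in> carrier W" using c cl by simp
      from le(1)[OF c(3)] le(2)[OF this] show False
        using that len1 less.prems(3) unfolding e by linarith
    qed
    have not4: "m i t \<noteq> 4"
      if "len v1 = Suc (len v2)" "len v2 = Suc (len v3)" "len v3 = Suc (len v4)"
    proof
      assume "m i t = 4"
      then have "w = v4 \<otimes> s t \<otimes> s i \<otimes> s t \<otimes> s i"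
        using braid_moves(3)[OF c(4) i t] w1 w2 w3 w4 by metis
      then have e: "w \<otimes> s i = v4 \<otimes> s t \<otimes> s i \<otimes> s t" using c cl i t by (simp add: s_cancel)
      have "v4 \<otimes> s t \<in> carrier W" "v4 \<otimes> s t \<otimes> s i \<in> carrier W" using c cl by simp_all
      from le(2)[OF c(4)] le(1)[OF this(1)] le(2)[OF this(2)] show False
        using that len1 less.prems(3) unfolding e by linarith
    qed
    consider (1) "len v1 < len (v1 \<otimes> s i)"
      | (2) "len v1 = Suc (len v2)" "len v2 < len (v2 \<otimes> s t)"
      | (3) "len v1 = Suc (len v2)" "len v2 = Suc (len v3)" "len v3 < len (v3 \<otimes> s i)"
      | (4) "len v1 = Suc (len v2)" "len v2 = Suc (len v3)" "len v3 = Suc (len v4)"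
      using desc[OF c(1) i] desc[OF c(2) t] desc[OF c(3) i]
      by (auto simp: v2_def v3_def v4_def)
    then show ?thesis
    proof cases
      case 1
      then have "weight_act x v1 i \<ge> 0" "weight_act x v1 t \<ge> 0"
        using IH[OF c(1)] len1 w1 by auto
      then show ?thesis
        using step(1)[OF c(1)] mult_nonneg_nonpos[OF _ b, of "weight_act x v1 t"]
        by (simp add: w1)
    next
      case 2
      then have "weight_act x v2 i \<ge> 0 \<and> weight_act x v2 t \<ge> 0"
        using IH[OF c(2)] len1 w2 by auto
      moreover have "weight_act x w i
          = - weight_act x v2 i - (weight_act x v2 t - weight_act x v2 i * ?a) * ?b"
        unfolding w1 step(1)[OF c(1)] unfolding w2 step(2)[OF c(2)] neg(2)[OF c(2)] by simp
      ultimately show ?thesis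
        using off_diag[OF i t it] not2 2 by auto
    next
      case 3
      then have "weight_act x v3 i \<ge> 0 \<and> weight_act x v3 t \<ge> 0"
        using IH[OF c(3)] len1 w3 by auto
      moreover have "weight_act x w i
          = - (weight_act x v3 i - weight_act x v3 t * ?b)
            - (- weight_act x v3 t - (weight_act x v3 i - weight_act x v3 t * ?b) * ?a) * ?b"
        unfolding w1 step(1)[OF c(1)] unfolding w2 step(2)[OF c(2)] neg(2)[OF c(2)]
        unfolding w3 step(1)[OF c(3)] neg(1)[OF c(3)] by simp
      ultimately show ?thesis
        using off_diag[OF i t it] not2 not3 3 by auto
    next
      case 4
      then show ?thesis using off_diag[OF i t it] not2 not3 not4 by auto
    qed
  qed
qed

lemma weight_nonpos_of_descent:
  assumes "\<And>i. i \<in> I \<Longrightarrow> x i \<ge> 0"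
    and "w \<in> carrier W" "i \<in> I" "len (w \<otimes> s i) < len w"
  shows "weight_act x w i \<le> 0"
  using weight_nonneg_of_ascent[of x "w \<otimes> s i" i] assms
  by (simp add: s_closed s_cancel weight_act_mult_s_self)

lemma weight_act_parabolic:
  assumes "J \<subseteq> I" "\<And>i. i \<in> J \<Longrightarrow> x i = 0" "p \<in> parabolic W s J"
  shows "weight_act x p = x"
proof -
  have J: "weight_act x (s i) = x" if "i \<in> J" for i
    using assms(1,2) that by (subst weight_act_s) (auto simp: fire_def)
  show ?thesis using assms(3) unfolding parabolic_def
  proof (induction rule: generate.induct)
    case one
    then show ?case by (simp add: weight_act_one)
  next
    case (incl h)
    then show ?case using J by auto
  next
    case (inv h)
    then obtain i where "i \<in> J" "h = s i" by auto
    then show ?case using J[of i] inv_s[of i] assms(1) by auto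
  next
    case (eng h1 h2)
    then have "h1 \<in> carrier W" "h2 \<in> carrier W"
      using parabolic_closed[OF assms(1)] by (auto simp: parabolic_def)
    then show ?case using eng by (simp add: weight_act_mult)
  qed
qed

text \<open>
  At a right descent \<open>i\<close> of \<open>w\<close> the coordinate \<open>(xw) i = x i\<close> is both nonpositive and nonnegative. So
  \<open>i \<in> J\<close>, and \<open>ws\<^sub>i\<close> still fixes \<open>x\<close>: the letters of a reduced word of \<open>w\<close> can be removed
  one after the other.
\<close>

lemma weight_stabilizer:
  assumes "J \<subseteq> I"
    and "\<And>i. i \<in> J \<Longrightarrow> x i = 0" and pos: "\<And>i. i \<in> I - J \<Longrightarrow> x i > 0"
    and "w \<in> carrier W" "weight_act x w = x"
  shows "w \<in> parabolic W s J"
  using assms(4,5)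
proof (induction "len w" arbitrary: w rule: less_induct)
  case less
  have dom: "x i \<ge> 0" if "i \<in> I" for i
    using assms(2) pos that by (cases "i \<in> J") (auto intro: less_imp_le)
  show ?case
  proof (cases "len w = 0")
    case True
    then show ?thesis
      using len_eq_0[OF less.prems(1)] generate.one[of W] by (simp add: parabolic_def)
  next
    case False
    then obtain i where i: "i \<in> I" "len w = Suc (len (w \<otimes> s i))"
      using ex_right_descent less.prems by blast
    have "x i \<le> 0"
      using weight_nonpos_of_descent[of x w i, OF dom less.prems(1) i(1)] i(2) less.prems(2) by simp
    then have iJ: "i \<in> J" using pos[of i] i(1) by force
    then have "fire A i x = x" using assms(2) by (auto simp: fire_def)
    then have "weight_act x (w \<otimes> s i) = x"
      using less.prems i(1) by (simp add: weight_act_mult_s)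
    then have "w \<otimes> s i \<in> parabolic W s J"
      using less.hyps[of "w \<otimes> s i"] i less.prems(1) s_closed by simp
    moreover have "s i \<in> parabolic W s J"
      using iJ by (auto simp: parabolic_def intro: generate.incl)
    ultimately have "w \<otimes> s i \<otimes> s i \<in> parabolic W s J"
      by (auto simp: parabolic_def intro: generate.eng)
    then show ?thesis using s_cancel[OF i(1) less.prems(1)] by simp
  qed
qed

text \<open>
  The coordinate vanishes exactly if \<open>s\<^sub>i\<close> fixes the weight \<open>xw\<close>, that is, if \<open>w\<close> and \<open>ws\<^sub>i\<close> lie in the
  same coset. Then they cannot both be minimal, as their lengths differ. Otherwise its sign, which
  depends only on the coset, decides for all elements of the coset at once whether \<open>s\<^sub>i\<close> raises or
  lowers the length.
\<close>

lemma mult_s_min_coset_rep_iff: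
  assumes "J \<subseteq> I"
    and x0: "\<And>i. i \<in> J \<Longrightarrow> x i = 0" and pos: "\<And>i. i \<in> I - J \<Longrightarrow> x i > 0"
    and w: "w \<in> min_coset_reps W I s J" and i: "i \<in> I"
  shows "w \<otimes> s i \<in> min_coset_reps W I s J \<longleftrightarrow> weight_act x w i \<noteq> 0"
proof
  have wc: "w \<in> carrier W" and wmin: "\<And>p. p \<in> parabolic W s J \<Longrightarrow> len w \<le> len (p \<otimes> w)"
    using w by (auto simp: min_coset_reps_iff)
  have dom: "x i \<ge> 0" if "i \<in> I" for i
    using x0 pos that by (cases "i \<in> J") (auto intro: less_imp_le)
  note sc = s_closed[OF i]
  {
    assume ws: "w \<otimes> s i \<in> min_coset_reps W I s J"
    show "weight_act x w i \<noteq> 0"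
    proof
      assume "weight_act x w i = 0"
      then have fixed: "weight_act x (w \<otimes> s i) = weight_act x w"
        by (simp add: weight_act_mult_s wc i fire_def)
      \<comment> \<open>\<open>p\<close> carries \<open>w\<close> to \<open>ws\<^sub>i\<close> and back, and lies in the parabolic subgroup since it fixes \<open>x\<close>.\<close>
      define p where "p = w \<otimes> s i \<otimes> inv w"
      have pc: "p \<in> carrier W" using wc sc by (simp add: p_def)
      have "weight_act x p = weight_act (weight_act x (w \<otimes> s i)) (inv w)"
        using wc sc by (simp add: p_def weight_act_mult)
      also have "\<dots> = weight_act x (w \<otimes> inv w)"
        unfolding fixed weight_act_mult[OF wc inv_closed[OF wc]] ..
      also have "\<dots> = x" using wc by (simp add: weight_act_one)
      finally have p: "p \<in> parabolic W s J"
        using weight_stabilizer[of J x p, OF assms(1) x0 pos pc] by blast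
      have pw: "p \<otimes> w = w \<otimes> s i"
        using wc sc by (simp add: p_def m_assoc)
      moreover have "p \<otimes> (w \<otimes> s i) = p \<otimes> w \<otimes> s i"
        using pc wc sc by (simp add: m_assoc)
      ultimately have pws: "p \<otimes> (w \<otimes> s i) = w"
        using s_cancel[OF i wc] by simp
      have "len (w \<otimes> s i) = len w"
        using p pw pws wmin[of p] ws by (auto simp: min_coset_reps_iff intro: antisym)
      then show False using len_mult_s[OF wc i] by simp
    qed
  }
  {
    assume nz: "weight_act x w i \<noteq> 0"
    have "len (w \<otimes> s i) \<le> len (p \<otimes> (w \<otimes> s i))" if p: "p \<in> parabolic W s J" for p
    proof (rule ccontr)
      have pc: "p \<in> carrier W" using parabolic_closed assms(1) p by blast
      \<comment> \<open>If \<open>?y\<close> were shorter than \<open>ws\<^sub>i\<close>, then \<open>s\<^sub>i\<close> would raise the lengths both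
        of \<open>?y\<close> and of \<open>w\<close>, whose weights have opposite \<open>i\<close>-th coordinates.\<close>
      let ?y = "p \<otimes> (w \<otimes> s i)"
      have yc: "?y \<in> carrier W" using pc wc sc by simp
      have ys: "?y \<otimes> s i = p \<otimes> w"
        using pc wc sc by (simp add: m_assoc s_square i)
      assume "\<not> ?thesis"
      then have lt: "len ?y < len (w \<otimes> s i)" by simp
      have le: "len w \<le> len (?y \<otimes> s i)" using wmin[OF p] ys by simp
      have "len ?y < len (?y \<otimes> s i)" "len w < len (w \<otimes> s i)"
        using lt le len_mult_s[OF yc i] len_mult_s[OF wc i] by linarith+
      moreover have "weight_act x ?y = weight_act x (w \<otimes> s i)"
        using weight_act_parabolic[of J x p, OF assms(1) x0 p] pc wc sc by (simp add: weight_act_mult)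
      ultimately show False
        using weight_nonneg_of_ascent[of x w i, OF dom wc i] weight_nonneg_of_ascent[of x ?y i, OF dom yc i] nz
        by (simp add: weight_act_mult_s_self wc i)
    qed
    then show "w \<otimes> s i \<in> min_coset_reps W I s J"
      using wc sc by (auto simp: min_coset_reps_iff)
  }
qed

lemma weight_act_invariant:
  assumes "w \<in> carrier W" "Q x" "\<And>i x. i \<in> I \<Longrightarrow> Q x \<Longrightarrow> Q (fire A i x)"
  shows "Q (weight_act x w)"
proof -
  obtain u where u: "u \<in> lists I" "w = word_prod W s u"
    using ex_word assms(1) by blast
  have "Q (fire_word x u)" using u(1) assms(2)
    by (induction u arbitrary: x) (auto intro: assms(3))
  then show ?thesis using u by (simp add: weight_act_word)
qed

end

section \<open>Minimal coset representatives at a double bond\<close>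

text \<open>
  Of the two Cartan matrices of rank \<open>n\<close> with a double bond at \<open>n\<close>, this is the one for which
  \<open>\<alpha>\<^sub>n\<^sup>\<or> = e\<^sub>n\<close>, so that integral vectors have integral coordinates. Types \<open>B\<close> and \<open>C\<close> share the
  Coxeter group, and the root lengths enter only through \<^const>\<open>short_root\<close>, so it serves for both.
\<close>

definition cartan_matrix :: "nat \<Rightarrow> nat \<Rightarrow> nat \<Rightarrow> int" where
  "cartan_matrix n i j =
     (if i = j then 2
      else if i = n \<and> Suc j = n then - 2
      else if i = Suc j \<or> j = Suc i then - 1
      else 0)"

text \<open>
  The pairing of the vector \<open>v\<close> with the coroots \<open>e\<^sub>i - e\<^sub>i\<^sub>+\<^sub>1\<close> and \<open>e\<^sub>n\<close>.
\<close>

definition weight_of_vector :: "nat \<Rightarrow> (nat \<Rightarrow> int) \<Rightarrow> nat \<Rightarrow> int" where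
  "weight_of_vector n v i = (if i = n then v n else v i - v (Suc i))"

definition signed_reflection :: "nat \<Rightarrow> nat \<Rightarrow> (nat \<Rightarrow> int) \<Rightarrow> nat \<Rightarrow> int" where
  "signed_reflection n i v =
     (if i = n then v(n := - v n) else v(i := v (Suc i), Suc i := v i))"

lemma fire_weight_of_vector:
  assumes "i \<in> {1..n}" "j \<in> {1..n}" "\<And>l. l \<in> {1..n} \<Longrightarrow> x l = weight_of_vector n v l"
  shows "fire (cartan_matrix n) i x j = weight_of_vector n (signed_reflection n i v) j"
  using assms(1,2) assms(3)[OF assms(1)] assms(3)[OF assms(2)]
  by (auto simp: fire_def cartan_matrix_def weight_of_vector_def signed_reflection_def)

lemma coxeter_matrix_BC:
  assumes "T = TypeB n \<or> T = TypeC n" "i \<in> {1..n}" "j \<in> {1..n}" "i \<noteq> j"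
  shows "coxeter_matrix T i j =
    (if Suc i = j \<or> Suc j = i then (if i = n \<or> j = n then 4 else 3) else 2)"
proof -
  have "{i, j} \<in> double_edges T \<longleftrightarrow> i = n - 1 \<and> j = n \<or> i = n \<and> j = n - 1"
    using assms(1) by (elim disjE) (simp_all add: doubleton_eq_iff)
  moreover have "{i, j} \<in> edges T \<longleftrightarrow> Suc i = j \<or> Suc j = i"
  proof -
    have "{i, j} \<in> edges T \<longleftrightarrow> (\<exists>l. {i, j} = {l, l + 1} \<and> 1 \<le> l \<and> l < n)"
      using assms(1) by (elim disjE) simp_all
    also have "\<dots> \<longleftrightarrow> Suc i = j \<or> Suc j = i"
    proof
      assume "Suc i = j \<or> Suc j = i"
      then show "\<exists>l. {i, j} = {l, l + 1} \<and> 1 \<le> l \<and> l < n"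
        using assms(2,3)
        by (elim disjE) (rule exI[of _ i], force, rule exI[of _ j], force)
    qed (auto simp: doubleton_eq_iff)
    finally show ?thesis .
  qed
  moreover have "i = n - 1 \<and> j = n \<or> i = n \<and> j = n - 1 \<longleftrightarrow>
      (Suc i = j \<or> Suc j = i) \<and> (i = n \<or> j = n)"
    using assms(2-4) by (simp, arith)
  ultimately show ?thesis
    using assms(4) by (simp add: coxeter_matrix_def)
qed

lemma cartan_coxeter_system_BC:
  assumes "T = TypeB n \<or> T = TypeC n"
    and "coxeter_system W (nodes T) s (coxeter_matrix T)"
  shows "cartan_coxeter_system W (nodes T) s (coxeter_matrix T) (cartan_matrix n)"
proof -
  interpret coxeter_system W "nodes T" s "coxeter_matrix T" by (rule assms(2))
  have N: "nodes T = {1..n}" using assms(1) by auto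
  show ?thesis
  proof
    fix i assume "i \<in> nodes T"
    then show "cartan_matrix n i i = 2" by (simp add: cartan_matrix_def)
  next
    fix i j assume ij: "i \<in> nodes T" "j \<in> nodes T" "i \<noteq> j"
    then have m: "coxeter_matrix T i j =
        (if Suc i = j \<or> Suc j = i then (if i = n \<or> j = n then 4 else 3) else 2)"
      using coxeter_matrix_BC[OF assms(1), of i j] unfolding N by blast
    consider "Suc i = j" "i < n" | "Suc j = i" "j < n" | "Suc i \<noteq> j" "Suc j \<noteq> i"
      using ij by (auto simp: N)
    then show "coxeter_matrix T i j = 2 \<and> cartan_matrix n i j = 0 \<and> cartan_matrix n j i = 0 \<or>
      coxeter_matrix T i j = 3 \<and> cartan_matrix n i j = - 1 \<and> cartan_matrix n j i = - 1 \<or>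
      coxeter_matrix T i j = 4 \<and> cartan_matrix n i j = - 1 \<and> cartan_matrix n j i = - 2 \<or>
      coxeter_matrix T i j = 4 \<and> cartan_matrix n i j = - 2 \<and> cartan_matrix n j i = - 1"
      by cases (use m ij(3) in \<open>simp_all add: cartan_matrix_def\<close>)
  qed
qed

lemma double_bond_nodes:
  assumes "hermitian_pair T k" "coxeter_matrix T i j = 4" "short_root T i"
  obtains n where "n \<ge> 2" "T = TypeB n" "k = 1" "i = n" "j = n - 1"
    | n where "n \<ge> 2" "T = TypeC n" "k = n" "i = n - 1" "j = n"
proof -
  have e: "{i, j} \<in> double_edges T"
    using assms(2) by (simp add: coxeter_matrix_def split: if_splits)
  show thesis
  proof (cases T)
    case (TypeB n)
    then have "n \<ge> 2" "k = 1" "i = n" "{i, j} = {n - 1, n}" using assms e by auto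
    then show thesis using that(1) TypeB by (auto simp: doubleton_eq_iff)
  next
    case (TypeC n)
    then have "n \<ge> 2" "k = n" "i \<noteq> n" "{i, j} = {n - 1, n}" using assms e by auto
    then show thesis using that(2) TypeC by (auto simp: doubleton_eq_iff)
  qed (use e in auto)
qed

text \<open>
  In terms of \<open>x = \<omega>\<^sub>kw\<close>, the hypothesis says \<open>x i \<noteq> 0\<close>, and the two conclusions say that \<open>x j \<noteq> 0\<close>
  and that the coordinate at \<open>i\<close> vanishes after firing \<open>j\<close>. In type \<open>B\<close>, \<open>x\<close> is the weight of a vector
  \<open>v\<close> with at most one nonzero entry, and \<open>x n = v n \<noteq> 0\<close> forces \<open>v (n - 1) = 0\<close>. In type \<open>C\<close> the
  entries of \<open>v\<close> have equal absolute values, and \<open>x (n - 1) = v (n - 1) - v n \<noteq> 0\<close> forces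
  \<open>v (n - 1) = - v n \<noteq> 0\<close>, while \<open>s\<^sub>n\<close> changes the sign of \<open>v n\<close>.
\<close>

lemma double_bond_min_coset_reps:
  fixes W (structure)
  assumes cox: "coxeter_system W (nodes T) s (coxeter_matrix T)"
    and pair: "hermitian_pair T k"
    and m: "coxeter_matrix T i j = 4" and short: "short_root T i"
    and w: "w \<in> oriented_reps W s T k" and wi: "w \<otimes> s i \<in> oriented_reps W s T k"
  shows "w \<otimes> s j \<in> oriented_reps W s T k"
    and "w \<otimes> s j \<otimes> s i \<notin> oriented_reps W s T k"
proof -
  define fund :: "nat \<Rightarrow> int" where "fund l = (if l = k then 1 else 0)" for l
  obtain n where n: "n \<ge> 2" and T: "T = TypeB n \<or> T = TypeC n"
    using double_bond_nodes[OF pair m short] by metis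
  interpret cartan_coxeter_system W "nodes T" s "coxeter_matrix T" "cartan_matrix n"
    using cartan_coxeter_system_BC[OF T cox] .
  have N: "nodes T = {1..n}" using T by auto
  have ij: "i \<in> nodes T" "j \<in> nodes T"
    by (rule double_bond_nodes[OF pair m short]; use T N in auto)+
  have reps: "oriented_reps W s T k = min_coset_reps W (nodes T) s (nodes T - {k})"
    by (simp add: oriented_reps_def)
  have iff: "v \<otimes> s l \<in> oriented_reps W s T k \<longleftrightarrow> weight_act fund v l \<noteq> 0"
    if "v \<in> oriented_reps W s T k" "l \<in> nodes T" for v l
    unfolding reps using that[unfolded reps]
    by (intro mult_s_min_coset_rep_iff) (auto simp: fund_def)
  have wc: "w \<in> carrier W" using w by (auto simp: reps min_coset_reps_iff)
  define good where
    "good x \<longleftrightarrow> x i \<noteq> 0 \<longrightarrow> x j \<noteq> 0 \<and> fire (cartan_matrix n) j x i = 0" for x :: "nat \<Rightarrow> int"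
  have "good (weight_act fund w)"
  proof (rule double_bond_nodes[OF pair m short])
    fix n' assume *: "n' \<ge> 2" "T = TypeB n'" "k = 1" "i = n'" "j = n' - 1"
    then have n': "n' = n" using T by auto
    define Q where "Q x \<longleftrightarrow> (\<exists>v a. (\<forall>l\<in>{1..n}. x l = weight_of_vector n v l) \<and>
      (\<forall>b\<in>{1..n}. b \<noteq> a \<longrightarrow> v b = 0))" for x
    have "Q (weight_act fund w)"
    proof (rule weight_act_invariant[OF wc])
      show "Q fund" unfolding Q_def
        using *
        by (intro exI[of _ "\<lambda>l. if l = 1 then 1 else 0"] exI[of _ 1])
           (auto simp: fund_def weight_of_vector_def n')
    next
      fix l x assume l: "l \<in> nodes T" and "Q x"
      then obtain v a where v: "\<And>l. l \<in> {1..n} \<Longrightarrow> x l = weight_of_vector n v l"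
        "\<And>b. b \<in> {1..n} \<Longrightarrow> b \<noteq> a \<Longrightarrow> v b = 0" unfolding Q_def by blast
      \<comment> \<open>The position of the nonzero entry is permuted along with the entries.\<close>
      define a' where
        "a' = (if l = n then a else if a = l then Suc l else if a = Suc l then l else a)"
      have "signed_reflection n l v b = 0" if "b \<in> {1..n}" "b \<noteq> a'" for b
        using v(2)[of b] v(2)[of l] v(2)[of "Suc l"] that l
        by (auto simp: signed_reflection_def N a'_def split: if_splits)
      then show "Q (fire (cartan_matrix n) l x)"
        unfolding Q_def using fire_weight_of_vector[OF l[unfolded N] _ v(1)] by blast
    qed
    then obtain v a where v: "\<And>l. l \<in> {1..n} \<Longrightarrow> weight_act fund w l = weight_of_vector n v l"
      "\<And>b. b \<in> {1..n} \<Longrightarrow> b \<noteq> a \<Longrightarrow> v b = 0" unfolding Q_def by blast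
    have v': "v (n - 1) = 0 \<or> v n = 0"
      using v(2)[of "n - 1"] v(2)[of n] n by (cases "n = a") auto
    show ?thesis
      using * n' v' v(1)[of "n - 1"] v(1)[of n]
      by (auto simp: good_def fire_def cartan_matrix_def weight_of_vector_def)
  next
    fix n' assume *: "n' \<ge> 2" "T = TypeC n'" "k = n'" "i = n' - 1" "j = n'"
    then have n': "n' = n" using T by auto
    define Q where "Q x \<longleftrightarrow> (\<exists>v c. (\<forall>l\<in>{1..n}. x l = weight_of_vector n v l) \<and>
      (\<forall>b\<in>{1..n}. \<bar>v b\<bar> = c))" for x
    have "Q (weight_act fund w)"
    proof (rule weight_act_invariant[OF wc])
      show "Q fund" unfolding Q_def
        using * by (intro exI[of _ "\<lambda>l. 1"] exI[of _ 1]) (auto simp: fund_def weight_of_vector_def n')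
    next
      fix l x assume l: "l \<in> nodes T" and "Q x"
      then obtain v c where v: "\<And>l. l \<in> {1..n} \<Longrightarrow> x l = weight_of_vector n v l"
        "\<And>b. b \<in> {1..n} \<Longrightarrow> \<bar>v b\<bar> = c" unfolding Q_def by blast
      have "\<bar>signed_reflection n l v b\<bar> = c" if "b \<in> {1..n}" for b
        using v(2)[of b] v(2)[of l] v(2)[of "Suc l"] that l
        by (auto simp: signed_reflection_def N)
      then show "Q (fire (cartan_matrix n) l x)"
        unfolding Q_def using fire_weight_of_vector[OF l[unfolded N] _ v(1)] by blast
    qed
    then obtain v c where v: "\<And>l. l \<in> {1..n} \<Longrightarrow> weight_act fund w l = weight_of_vector n v l"
      "\<And>b. b \<in> {1..n} \<Longrightarrow> \<bar>v b\<bar> = c" unfolding Q_def by blast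
    have v': "\<bar>v (n - 1)\<bar> = \<bar>v n\<bar>"
      using v(2)[of "n - 1"] v(2)[of n] * n' by auto
    show ?thesis
      using * n' v' v(1)[of "n - 1"] v(1)[of n]
      by (auto simp: good_def fire_def cartan_matrix_def weight_of_vector_def)
  qed
  then show wj: "w \<otimes> s j \<in> oriented_reps W s T k"
    using iff[OF w] wi ij by (auto simp: good_def)
  show "w \<otimes> s j \<otimes> s i \<notin> oriented_reps W s T k"
    using iff[OF wj ij(1)] iff[OF w ij(1)] wi \<open>good (weight_act fund w)\<close> wc ij
    by (auto simp: good_def weight_act_mult_s)
qed

section \<open>Homomorphisms between presented algebras\<close>

text \<open>
  The homomorphism of free algebras that renames the generators along \<open>g\<close>.
\<close>

definition relabel :: "('g \<Rightarrow> 'h) \<Rightarrow> 'g ncpoly \<Rightarrow> 'h ncpoly" where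
  "relabel g f =
     (\<Sum>w\<in>Poly_Mapping.keys f.
        Poly_Mapping.single (Fmon (map g (letters w))) (Poly_Mapping.lookup f w))"

lemma relabel_superset:
  assumes "finite S" "Poly_Mapping.keys f \<subseteq> S"
  shows "relabel g f =
    (\<Sum>w\<in>S. Poly_Mapping.single (Fmon (map g (letters w))) (Poly_Mapping.lookup f w))"
  unfolding relabel_def
  by (rule sum.mono_neutral_left[OF assms]) (simp add: in_keys_iff)

lemma relabel_single:
  "relabel g (Poly_Mapping.single w c) = Poly_Mapping.single (Fmon (map g (letters w))) c"
  by (subst relabel_superset[of "{w}"]) auto

lemma relabel_add: "relabel g (f + f') = relabel g f + relabel g f'"
proof -
  let ?S = "Poly_Mapping.keys f \<union> Poly_Mapping.keys f'"
  have "Poly_Mapping.keys (f + f') \<subseteq> ?S" by (rule keys_add)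
  then show ?thesis
    by (simp add: relabel_superset[of ?S] lookup_add single_add sum.distrib)
qed

lemma relabel_zero: "relabel g 0 = 0"
  by (simp add: relabel_def)

lemma relabel_sum: "relabel g (sum F S) = (\<Sum>x\<in>S. relabel g (F x))"
  by (induction S rule: infinite_finite_induct) (simp_all add: relabel_zero relabel_add)

lemma ncpoly_expand:
  "f = (\<Sum>w\<in>Poly_Mapping.keys f. Poly_Mapping.single w (Poly_Mapping.lookup f w))"
  for f :: "'g ncpoly"
  by (rule poly_mapping_eqI)
     (auto simp: lookup_sum lookup_single when_def sum.delta in_keys_iff)

lemma relabel_mult: "relabel g (f * f') = relabel g f * relabel g f'"
proof -
  let ?m = "\<lambda>f w. Poly_Mapping.single w (Poly_Mapping.lookup f w)"
  let ?K = "Poly_Mapping.keys f" and ?K' = "Poly_Mapping.keys f'"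
  have "relabel g (f * f') = relabel g (sum (?m f) ?K * sum (?m f') ?K')"
    by (simp flip: ncpoly_expand)
  also have "\<dots> = (\<Sum>u\<in>?K. \<Sum>v\<in>?K'. relabel g (?m f u) * relabel g (?m f' v))"
    by (simp add: sum_product relabel_sum mult_single relabel_single plus_fmon_def)
  also have "\<dots> = relabel g (sum (?m f) ?K) * relabel g (sum (?m f') ?K')"
    by (simp add: sum_product relabel_sum)
  finally show ?thesis by (simp flip: ncpoly_expand)
qed

lemma relabel_gen: "relabel g (gen x) = gen (g x)"
  by (simp add: gen_def relabel_single)

lemma relabel_scale: "relabel g (scale c f) = scale c (relabel g f)"
  by (simp add: scale_def relabel_mult relabel_single zero_fmon_def)

lemma relabel_one: "relabel g 1 = 1"
  using relabel_single[of g 0 1] by (simp add: zero_fmon_def flip: single_one)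

lemma keys_relabel:
  assumes "w \<in> Poly_Mapping.keys (relabel g f)"
  obtains u where "u \<in> Poly_Mapping.keys f" "w = Fmon (map g (letters u))"
proof -
  have "Poly_Mapping.lookup (relabel g f) w \<noteq> 0" using assms by (simp add: in_keys_iff)
  then obtain u where "u \<in> Poly_Mapping.keys f"
    "Poly_Mapping.lookup
       (Poly_Mapping.single (Fmon (map g (letters u))) (Poly_Mapping.lookup f u)) w \<noteq> 0"
    unfolding relabel_def lookup_sum by (meson sum.neutral)
  then show thesis using that by (auto simp: lookup_single when_def split: if_splits)
qed

lemma scale_two: "scale 2 f = f + f"
proof -
  have "Poly_Mapping.single 0 (2::laurent) = (1 + 1 :: 'a ncpoly)"
    by (simp flip: single_one single_add)
  then show ?thesis by (simp add: scale_def mult_2)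
qed

lemma scale_add: "scale (c + d) f = scale c f + scale d f"
  by (simp add: scale_def single_add distrib_right)

text \<open>
  Scalars commute with words because the empty word does and the Laurent polynomials are
  commutative.
\<close>

lemma constants_central: "Poly_Mapping.single 0 c * f = f * Poly_Mapping.single 0 c"
  for f :: "'g ncpoly"
proof -
  have "Poly_Mapping.single 0 c * f
      = (\<Sum>w\<in>Poly_Mapping.keys f. Poly_Mapping.single w (c * Poly_Mapping.lookup f w))"
    by (subst ncpoly_expand[of f]) (simp add: sum_distrib_left mult_single)
  also have "\<dots> = f * Poly_Mapping.single 0 c"
    by (subst (3) ncpoly_expand[of f]) (simp add: sum_distrib_right mult_single mult.commute)
  finally show ?thesis .
qed

lemma mult_scale: "a * scale c b = scale c (a * b)"
  using constants_central[of c a] by (simp add: scale_def flip: mult.assoc)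

lemma scale_mult: "scale c a * b = scale c (a * b)"
  by (simp add: scale_def mult.assoc)

lemma scale_zero: "scale c 0 = 0"
  by (simp add: scale_def)

abbreviation free_carrier :: "'g set \<Rightarrow> 'g ncpoly set" where
  "free_carrier X \<equiv> carrier (free_algebra X)"

lemma free_algebra_simps:
  "monoid.mult (free_algebra X) = (*)" "one (free_algebra X) = 1"
  "ring.zero (free_algebra X) = 0" "add (free_algebra X) = (+)" "smult (free_algebra X) = scale"
  by (simp_all add: free_algebra_def)

lemma free_carrier_iff:
  "f \<in> free_carrier X \<longleftrightarrow> (\<forall>w\<in>Poly_Mapping.keys f. set (letters w) \<subseteq> X)"
  by (simp add: free_algebra_def)

lemma free_carrier_add: "f \<in> free_carrier X \<Longrightarrow> f' \<in> free_carrier X \<Longrightarrow> f + f' \<in> free_carrier X"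
  using keys_add[of f f'] unfolding free_carrier_iff by blast

lemma free_carrier_mult:
  assumes "f \<in> free_carrier X" "f' \<in> free_carrier X"
  shows "f * f' \<in> free_carrier X"
  unfolding free_carrier_iff
proof
  fix w assume "w \<in> Poly_Mapping.keys (f * f')"
  then obtain u v where "w = u + v" "u \<in> Poly_Mapping.keys f" "v \<in> Poly_Mapping.keys f'"
    using keys_mult[of f f'] by blast
  then show "set (letters w) \<subseteq> X"
    using assms unfolding free_carrier_iff by (auto simp: plus_fmon_def)
qed

lemma free_carrier_uminus: "f \<in> free_carrier X \<Longrightarrow> - f \<in> free_carrier X"
  by (simp add: free_carrier_iff in_keys_iff)

lemma free_carrier_diff:
  "f \<in> free_carrier X \<Longrightarrow> f' \<in> free_carrier X \<Longrightarrow> f - f' \<in> free_carrier X"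
  using free_carrier_add[of f X "- f'"] free_carrier_uminus[of f' X] by simp

lemma free_carrier_zero: "0 \<in> free_carrier X"
  by (simp add: free_carrier_iff)

lemma free_carrier_const: "Poly_Mapping.single 0 c \<in> free_carrier X"
  by (simp add: free_carrier_iff zero_fmon_def)

lemma free_carrier_one: "1 \<in> free_carrier X"
  using free_carrier_const[of 1 X] by (simp flip: single_one)

lemma free_carrier_gen: "x \<in> X \<Longrightarrow> gen x \<in> free_carrier X"
  by (simp add: free_carrier_iff gen_def)

lemma free_carrier_scale: "f \<in> free_carrier X \<Longrightarrow> scale c f \<in> free_carrier X"
  unfolding scale_def by (intro free_carrier_mult free_carrier_const)

lemma free_carrier_sum: "(\<And>i. i \<in> S \<Longrightarrow> F i \<in> free_carrier X) \<Longrightarrow> sum F S \<in> free_carrier X"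
  by (induction S rule: infinite_finite_induct) (auto intro: free_carrier_zero free_carrier_add)

lemmas free_carrier_intros =
  free_carrier_add free_carrier_mult free_carrier_uminus free_carrier_diff free_carrier_zero
  free_carrier_one free_carrier_gen free_carrier_scale free_carrier_sum

lemma ring_free_algebra: "ring (free_algebra X)"
proof (rule ringI)
  show "abelian_group (free_algebra X)"
  proof (rule abelian_groupI)
    fix f assume "f \<in> free_carrier X"
    then show "\<exists>f'\<in>free_carrier X. f' \<oplus>\<^bsub>free_algebra X\<^esub> f = \<zero>\<^bsub>free_algebra X\<^esub>"
      by (intro bexI[of _ "- f"]) (auto simp: free_algebra_simps intro: free_carrier_uminus)
  qed (auto simp: free_algebra_simps intro: free_carrier_intros)
  show "Group.monoid (free_algebra X)"
    by (rule monoidI) (auto simp: free_algebra_simps mult.assoc intro: free_carrier_intros)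
qed (auto simp: free_algebra_simps algebra_simps)

lemma relabel_closed:
  assumes "g ` X \<subseteq> Y" "f \<in> free_carrier X"
  shows "relabel g f \<in> free_carrier Y"
  unfolding free_carrier_iff
proof
  fix w assume "w \<in> Poly_Mapping.keys (relabel g f)"
  then obtain u where "u \<in> Poly_Mapping.keys f" "w = Fmon (map g (letters u))"
    by (rule keys_relabel)
  then show "set (letters w) \<subseteq> Y"
    using assms unfolding free_carrier_iff by fastforce
qed

lemma relabel_ring_hom:
  "g ` X \<subseteq> Y \<Longrightarrow> relabel g \<in> ring_hom (free_algebra X) (free_algebra Y)"
  by (rule ring_hom_memI)
     (auto simp: free_algebra_simps relabel_add relabel_mult relabel_one intro: relabel_closed)

text \<open>
  If some relator lay outside the free algebra on \<open>X\<close>, no ideal of it would contain the relators, and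
  \<^const>\<open>relation_ideal\<close> would be the whole type.
\<close>

locale algebra_presentation =
  fixes X :: "'g set" and R :: "('g ncpoly \<times> 'g ncpoly) set"
  assumes relations_closed: "(l, r) \<in> R \<Longrightarrow> l \<in> free_carrier X \<and> r \<in> free_carrier X"
begin

abbreviation J :: "'g ncpoly set" where
  "J \<equiv> relation_ideal X R"

sublocale ideal J "free_algebra X"
  unfolding relation_ideal_def
  by (rule ring.genideal_ideal[OF ring_free_algebra])
     (auto dest: relations_closed intro: free_carrier_diff)

lemma ideal_zero: "0 \<in> J"
    and ideal_add: "a \<in> J \<Longrightarrow> b \<in> J \<Longrightarrow> a + b \<in> J"
    and ideal_mult_left: "a \<in> J \<Longrightarrow> c \<in> free_carrier X \<Longrightarrow> c * a \<in> J"
    and ideal_mult_right: "a \<in> J \<Longrightarrow> c \<in> free_carrier X \<Longrightarrow> a * c \<in> J"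
  using additive_subgroup.zero_closed[OF additive_subgroup_axioms]
    additive_subgroup.a_closed[OF additive_subgroup_axioms] I_l_closed I_r_closed
  by (simp_all add: free_algebra_simps)

lemma ideal_uminus: "a \<in> J \<Longrightarrow> - a \<in> J"
  using ideal_mult_left[of a "- 1"] by (simp add: free_carrier_uminus free_carrier_one)

lemma ideal_diff: "a \<in> J \<Longrightarrow> b \<in> J \<Longrightarrow> a - b \<in> J"
  using ideal_add[of a "- b"] ideal_uminus[of b] by simp

lemma relation_in_ideal: "(l, r) \<in> R \<Longrightarrow> l - r \<in> J"
  unfolding relation_ideal_def
  by (rule subsetD[OF ring.genideal_self[OF ring_free_algebra]])
     (auto dest: relations_closed intro: free_carrier_diff)

lemma coset_eq: "J +>\<^bsub>free_algebra X\<^esub> a = (\<lambda>j. j + a) ` J"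
  by (auto simp: a_r_coset_def r_coset_def free_algebra_simps)

lemma coset_eq_iff: "J +>\<^bsub>free_algebra X\<^esub> a = J +>\<^bsub>free_algebra X\<^esub> b \<longleftrightarrow> a - b \<in> J"
proof
  assume "J +>\<^bsub>free_algebra X\<^esub> a = J +>\<^bsub>free_algebra X\<^esub> b"
  then have "a \<in> (\<lambda>j. j + b) ` J"
    using ideal_zero unfolding coset_eq by (metis add_0 image_eqI)
  then show "a - b \<in> J" by auto
next
  assume ab: "a - b \<in> J"
  have "j + a = (j + (a - b)) + b" "j + b = (j - (a - b)) + a" for j by simp_all
  then show "J +>\<^bsub>free_algebra X\<^esub> a = J +>\<^bsub>free_algebra X\<^esub> b"
    unfolding coset_eq using ideal_add[OF _ ab] ideal_diff[OF _ ab] by blast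
qed

text \<open>
  Equality of the classes of \<open>a\<close> and \<open>b\<close> in the presented algebra. Requiring membership in the free
  algebra here keeps the congruence rules free of side conditions.
\<close>

definition cong :: "'g ncpoly \<Rightarrow> 'g ncpoly \<Rightarrow> bool" (infix "\<approx>" 50) where
  "a \<approx> b \<longleftrightarrow> a \<in> free_carrier X \<and> b \<in> free_carrier X \<and> a - b \<in> J"

lemma cong_refl: "a \<in> free_carrier X \<Longrightarrow> a \<approx> a"
  by (simp add: cong_def ideal_zero)

lemma cong_sym: "a \<approx> b \<Longrightarrow> b \<approx> a"
  using ideal_uminus[of "a - b"] by (simp add: cong_def)

lemma cong_trans [trans]: "a \<approx> b \<Longrightarrow> b \<approx> c \<Longrightarrow> a \<approx> c"
  using ideal_add[of "a - b" "b - c"] by (simp add: cong_def)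

lemma cong_add: "a \<approx> b \<Longrightarrow> c \<approx> d \<Longrightarrow> a + c \<approx> b + d"
  using ideal_add[of "a - b" "c - d"]
  by (simp add: cong_def free_carrier_add algebra_simps)

lemma cong_mult:
  assumes "a \<approx> b" "c \<approx> d"
  shows "a * c \<approx> b * d"
proof -
  have "a * (c - d) + (a - b) * d \<in> J"
    using assms by (auto simp: cong_def intro: ideal_add ideal_mult_left ideal_mult_right)
  moreover have "a * (c - d) + (a - b) * d = a * c - b * d" by (simp add: algebra_simps)
  ultimately show ?thesis using assms by (simp add: cong_def free_carrier_mult)
qed

lemma cong_scale: "a \<approx> b \<Longrightarrow> scale c a \<approx> scale c b"
  unfolding scale_def by (intro cong_mult cong_refl free_carrier_const)

lemma cong_sum: "(\<And>i. i \<in> S \<Longrightarrow> F i \<approx> G i) \<Longrightarrow> sum F S \<approx> sum G S"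
  by (induction S rule: infinite_finite_induct)
     (auto intro: cong_refl free_carrier_zero cong_add)

lemma cong_relation: "(l, r) \<in> R \<Longrightarrow> l \<approx> r"
  using relations_closed[of l r] relation_in_ideal[of l r] by (simp add: cong_def)

lemma cong_sum_support:
  assumes "finite S" "S' \<subseteq> S" "\<And>i. i \<in> S' \<Longrightarrow> F i \<approx> G i" "\<And>i. i \<in> S - S' \<Longrightarrow> F i \<approx> 0"
  shows "sum F S \<approx> sum G S'"
proof -
  have "sum F S \<approx> (\<Sum>i\<in>S. if i \<in> S' then G i else 0)"
    using assms(3,4) by (intro cong_sum) auto
  also have "(\<Sum>i\<in>S. if i \<in> S' then G i else 0) = sum G S'"
    using assms(1,2) by (simp add: sum.inter_restrict[symmetric] Int_absorb1)
  finally show ?thesis .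
qed

end

lemma presented_algebra_simps:
  "carrier (presented_algebra X R) =
     (\<lambda>a. relation_ideal X R +>\<^bsub>free_algebra X\<^esub> a) ` free_carrier X"
  "monoid.mult (presented_algebra X R) = rcoset_mult (free_algebra X) (relation_ideal X R)"
  "one (presented_algebra X R) = relation_ideal X R +>\<^bsub>free_algebra X\<^esub> 1"
  "add (presented_algebra X R) = set_add (free_algebra X)"
  "smult (presented_algebra X R) = (\<lambda>c K. \<Union>x\<in>K. relation_ideal X R +>\<^bsub>free_algebra X\<^esub> scale c x)"
  by (auto simp: presented_algebra_def quotient_algebra_def FactRing_def ring.defs module.defs
      A_RCOSETS_defs a_r_coset_def free_algebra_simps)

lemma (in algebra_presentation) presented_smult:
  assumes "a \<in> free_carrier X"
  shows "c \<odot>\<^bsub>presented_algebra X R\<^esub> (J +>\<^bsub>free_algebra X\<^esub> a) =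
    J +>\<^bsub>free_algebra X\<^esub> scale c a"
proof -
  have "J +>\<^bsub>free_algebra X\<^esub> scale c b = J +>\<^bsub>free_algebra X\<^esub> scale c a"
    if b: "b \<in> J +>\<^bsub>free_algebra X\<^esub> a" for b
  proof -
    obtain j where j: "j \<in> J" "b = j + a" using b unfolding coset_eq by blast
    then have "scale c b - scale c a = Poly_Mapping.single 0 c * j"
      by (simp add: scale_def algebra_simps)
    then show ?thesis
      using ideal_mult_left[OF j(1) free_carrier_const] by (simp add: coset_eq_iff)
  qed
  moreover have "a \<in> J +>\<^bsub>free_algebra X\<^esub> a"
    unfolding coset_eq using ideal_zero by (metis add_0 image_eqI)
  ultimately show ?thesis
    unfolding presented_algebra_simps by blast
qed

text \<open>
  Since the elements whose renaming lies in the target ideal form an ideal, it suffices that the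
  relators are renamed into it; the renaming then descends to the cosets.
\<close>

lemma presented_algebra_hom:
  assumes "algebra_presentation X R" "algebra_presentation Y R'" and g: "g ` X \<subseteq> Y"
    and rel: "\<And>l r. (l, r) \<in> R \<Longrightarrow> algebra_presentation.cong Y R' (relabel g l) (relabel g r)"
  shows "\<exists>h\<in>algebra_hom (presented_algebra X R) (presented_algebra Y R').
    \<forall>x\<in>X. h (presented_gen X R x) = presented_gen Y R' (g x)"
proof -
  interpret P: algebra_presentation X R by fact
  interpret Q: algebra_presentation Y R' by fact
  let ?A = "free_algebra X" and ?B = "free_algebra Y"
  define h where "h K = (\<Union>a\<in>K. Q.J +>\<^bsub>?B\<^esub> relabel g a)" for K
  interpret H: ring_hom_ring ?A ?B "relabel g"
    by (intro ring_hom_ringI2 ring_free_algebra relabel_ring_hom g)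
  have "{l - r | l r. (l, r) \<in> R} \<subseteq> {a \<in> free_carrier X. relabel g a \<in> Q.J}"
  proof safe
    fix l r assume lr: "(l, r) \<in> R"
    then show "l - r \<in> free_carrier X"
      using P.relations_closed free_carrier_diff by blast
    have "relabel g (l - r) + relabel g r = relabel g l"
      by (simp flip: relabel_add)
    then have "relabel g (l - r) = relabel g l - relabel g r"
      by (metis add_diff_cancel)
    then show "relabel g (l - r) \<in> Q.J" using rel[OF lr] by (simp add: Q.cong_def)
  qed
  then have "P.J \<subseteq> {a \<in> free_carrier X. relabel g a \<in> Q.J}"
    unfolding relation_ideal_def[of X R]
    by (intro ring.genideal_minimal ring_free_algebra H.ideal_vimage Q.ideal_axioms)
  then have J: "relabel g a \<in> Q.J" if "a \<in> P.J" for a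
    using that by blast
  have h: "h (P.J +>\<^bsub>?A\<^esub> a) = Q.J +>\<^bsub>?B\<^esub> relabel g a" for a
  proof -
    have "Q.J +>\<^bsub>?B\<^esub> relabel g b = Q.J +>\<^bsub>?B\<^esub> relabel g a"
      if b: "b \<in> P.J +>\<^bsub>?A\<^esub> a" for b
    proof -
      obtain j where "j \<in> P.J" "b = j + a" using b unfolding P.coset_eq by blast
      then show ?thesis using J by (simp add: Q.coset_eq_iff relabel_add)
    qed
    moreover have "a \<in> P.J +>\<^bsub>?A\<^esub> a"
      unfolding P.coset_eq using P.ideal_zero by (metis add_0 image_eqI)
    ultimately show ?thesis unfolding h_def by blast
  qed
  have "h \<in> algebra_hom (presented_algebra X R) (presented_algebra Y R')"
    unfolding algebra_hom_def
  proof (intro CollectI conjI allI ballI ring_hom_memI)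
    fix c K assume "K \<in> carrier (presented_algebra X R)"
    then obtain a where a: "a \<in> free_carrier X" "K = P.J +>\<^bsub>?A\<^esub> a"
      by (auto simp: presented_algebra_simps)
    then show "h (c \<odot>\<^bsub>presented_algebra X R\<^esub> K) = c \<odot>\<^bsub>presented_algebra Y R'\<^esub> h K"
      using relabel_closed[OF g a(1)]
      by (simp add: P.presented_smult Q.presented_smult h relabel_scale)
  next
    fix K assume "K \<in> carrier (presented_algebra X R)"
    then show "h K \<in> carrier (presented_algebra Y R')"
      using relabel_closed[OF g] by (auto simp: presented_algebra_simps h)
  next
    fix K L assume "K \<in> carrier (presented_algebra X R)" "L \<in> carrier (presented_algebra X R)"
    then obtain a b where ab: "a \<in> free_carrier X" "K = P.J +>\<^bsub>?A\<^esub> a"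
      "b \<in> free_carrier X" "L = P.J +>\<^bsub>?A\<^esub> b"
      by (auto simp: presented_algebra_simps)
    note ab' = relabel_closed[OF g ab(1)] relabel_closed[OF g ab(3)]
    show "h (K \<otimes>\<^bsub>presented_algebra X R\<^esub> L) = h K \<otimes>\<^bsub>presented_algebra Y R'\<^esub> h L"
      using P.rcoset_mult_add[OF ab(1,3)] Q.rcoset_mult_add[OF ab']
      by (simp add: presented_algebra_simps ab h free_algebra_simps relabel_mult)
    show "h (K \<oplus>\<^bsub>presented_algebra X R\<^esub> L) = h K \<oplus>\<^bsub>presented_algebra Y R'\<^esub> h L"
      using P.a_rcos_sum[OF ab(1,3)] Q.a_rcos_sum[OF ab']
      by (simp add: presented_algebra_simps ab h free_algebra_simps relabel_add)
  next
    show "h \<one>\<^bsub>presented_algebra X R\<^esub> = \<one>\<^bsub>presented_algebra Y R'\<^esub>"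
      by (simp add: presented_algebra_simps h relabel_one)
  qed
  moreover have "h (presented_gen X R x) = presented_gen Y R' (g x)" if "x \<in> X" for x
    using that by (simp add: presented_gen_def h relabel_gen)
  ultimately show ?thesis by blast
qed

section \<open>The Temperley--Lieb relations in the oriented algebra\<close>

text \<open>
  Whether \<open>act x i\<close> lies again in \<open>D\<close> decides which components of \<open>E\<^sub>i\<close> vanish. The second assumption
  gives the exponents \<open>\<plusminus>1\<close> of the quadratic relation, the last one is the combinatorial input to the
  quartic relation.
\<close>

locale oriented_presentation =
  fixes I :: "nat set" and m :: "nat \<Rightarrow> nat \<Rightarrow> nat" and short :: "nat \<Rightarrow> bool"
    and D :: "'w set" and l :: "'w \<Rightarrow> nat" and act :: "'w \<Rightarrow> nat \<Rightarrow> 'w"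
  assumes act_act: "\<lbrakk>i \<in> I; x \<in> D\<rbrakk> \<Longrightarrow> act (act x i) i = x"
    and length_act: "\<lbrakk>i \<in> I; x \<in> D\<rbrakk> \<Longrightarrow> l (act x i) = Suc (l x) \<or> l x = Suc (l (act x i))"
    and short_or: "\<lbrakk>i \<in> I; j \<in> I; m i j = 4\<rbrakk> \<Longrightarrow> m j i = 4 \<and> (short i \<or> short j)"
    and double_bond:
      "\<lbrakk>i \<in> I; j \<in> I; m i j = 4; short i; x \<in> D; act x i \<in> D\<rbrakk> \<Longrightarrow>
         act x j \<in> D \<and> act (act x j) i \<notin> D"
begin

sublocale algebra_presentation "oriented_gens I D" "oriented_TL_relations I m short D l act"
proof
  fix a b :: "'w oriented_gen ncpoly"
  assume "(a, b) \<in> oriented_TL_relations I m short D l act"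
  then show "a \<in> free_carrier (oriented_gens I D) \<and> b \<in> free_carrier (oriented_gens I D)"
    unfolding oriented_TL_relations_def
    by (elim UnE) (auto simp: oriented_gens_def intro!: free_carrier_intros)
qed

notation cong (infix "\<approx>" 50)

lemma idem_closed: "x \<in> D \<Longrightarrow> idem x \<in> free_carrier (oriented_gens I D)"
  and edge_closed: "i \<in> I \<Longrightarrow> edge i \<in> free_carrier (oriented_gens I D)"
  by (auto simp: oriented_gens_def intro: free_carrier_gen)

lemma sum_idem: "1 \<approx> (\<Sum>x\<in>D. idem x)"
  by (rule cong_sym, rule cong_relation) (simp add: oriented_TL_relations_def)

lemma idem_edge_idem_zero:
  assumes "x \<in> D" "y \<in> D" "i \<in> I" "act x i \<notin> D \<or> y \<notin> {x, act x i}"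
  shows "idem x * edge i * idem y \<approx> 0"
proof (cases "y \<in> {x, act x i}")
  case True
  then have y: "y = x" and "act x i \<notin> D" using assms by auto
  then have "(idem x * edge i * idem x, 0) \<in> oriented_TL_relations I m short D l act"
    unfolding oriented_TL_relations_def using assms by blast
  then show ?thesis unfolding y by (rule cong_relation)
next
  case False
  then have "(idem x * edge i * idem y, 0) \<in> oriented_TL_relations I m short D l act"
    unfolding oriented_TL_relations_def using assms by blast
  then show ?thesis by (rule cong_relation)
qed

lemma square_relation:
  assumes "i \<in> I" "x \<in> D" "act x i \<in> D" "y \<in> {x, act x i}" "z \<in> {x, act x i}"
  shows "idem y * edge i * idem x * edge i * idem z \<approx>
    scale (q_pow (int (l (act x i)) - int (l x))) (idem y * edge i * idem z)"
proof (rule cong_relation)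
  show "(idem y * edge i * idem x * edge i * idem z,
      scale (q_pow (int (l (act x i)) - int (l x))) (idem y * edge i * idem z))
      \<in> oriented_TL_relations I m short D l act"
    unfolding oriented_TL_relations_def using assms by blast
qed

lemma double_bond_relation:
  assumes "i \<in> I" "j \<in> I" "m i j = 4" "short i" "x \<in> D" "act x i \<in> D" "act x j \<in> D"
    "y \<in> {x, act x i}" "z \<in> {x, act x i}"
  shows "idem y * edge i * idem x * edge j * idem x * edge i * idem z \<approx> idem y * edge i * idem z"
proof (rule cong_relation)
  show "(idem y * edge i * idem x * edge j * idem x * edge i * idem z, idem y * edge i * idem z)
      \<in> oriented_TL_relations I m short D l act"
    unfolding oriented_TL_relations_def using assms by blast
qed

lemma edge_commute:
  assumes "i \<in> I" "j \<in> I" "m i j = 2"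
  shows "edge i * edge j \<approx> edge j * edge i"
proof (rule cong_relation)
  show "(edge i * edge j, edge j * edge i) \<in> oriented_TL_relations I m short D l act"
    unfolding oriented_TL_relations_def using assms by blast
qed

lemma edge_braid:
  assumes "i \<in> I" "j \<in> I" "m i j = 3"
  shows "edge i * edge j * edge i \<approx> edge i"
proof (rule cong_relation)
  show "(edge i * edge j * edge i, edge i) \<in> oriented_TL_relations I m short D l act"
    unfolding oriented_TL_relations_def using assms by blast
qed

lemma cong_insert_idem:
  assumes "a \<in> free_carrier (oriented_gens I D)" "b \<in> free_carrier (oriented_gens I D)"
  shows "a * b \<approx> (\<Sum>y\<in>D. a * idem y * b)"
proof -
  have "a * 1 * b \<approx> a * (\<Sum>y\<in>D. idem y) * b"
    using assms by (intro cong_mult cong_refl sum_idem)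
  then show ?thesis by (simp add: sum_distrib_left sum_distrib_right)
qed

text \<open>
  Insert \<open>1 = \<Sum>\<^sub>x 1\<^sub>x\<close> on both sides. If \<open>D\<close> is infinite, the sum over \<open>D\<close> is \<open>0\<close> by convention, so
  that \<open>1 = 0\<close> in the algebra, and any two elements are congruent.
\<close>

lemma cong_peirce:
  assumes "a \<in> free_carrier (oriented_gens I D)" "b \<in> free_carrier (oriented_gens I D)"
    and "\<And>x z. finite D \<Longrightarrow> x \<in> D \<Longrightarrow> z \<in> D \<Longrightarrow> idem x * a * idem z \<approx> idem x * b * idem z"
  shows "a \<approx> b"
proof -
  have exp: "c \<approx> (\<Sum>x\<in>D. \<Sum>z\<in>D. idem x * c * idem z)"
    if "c \<in> free_carrier (oriented_gens I D)" for c
  proof -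
    have "1 * c * 1 \<approx> (\<Sum>x\<in>D. idem x) * c * (\<Sum>z\<in>D. idem z)"
      using that by (intro cong_mult cong_refl sum_idem)
    then show ?thesis
      by (subst sum.swap) (simp add: sum_distrib_left sum_distrib_right)
  qed
  have "(\<Sum>x\<in>D. \<Sum>z\<in>D. idem x * a * idem z) \<approx> (\<Sum>x\<in>D. \<Sum>z\<in>D. idem x * b * idem z)"
  proof (cases "finite D")
    case True
    then show ?thesis by (intro cong_sum assms(3))
  next
    case False
    then show ?thesis by (simp add: cong_refl free_carrier_zero)
  qed
  then show ?thesis
    using exp[OF assms(1)] cong_sym[OF exp[OF assms(2)]] cong_trans by blast
qed

lemma act_neq: "i \<in> I \<Longrightarrow> x \<in> D \<Longrightarrow> act x i \<noteq> x"
  using length_act by fastforce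

lemma edge_square:
  assumes i: "i \<in> I"
  shows "edge i * edge i \<approx> scale (q_pow 1 + q_pow (- 1)) (edge i)"
proof (rule cong_peirce)
  fix x z assume fin: "finite D" and x: "x \<in> D" and z: "z \<in> D"
  note cl = idem_closed[OF x] idem_closed[OF z] edge_closed[OF i]
  let ?c = "q_pow 1 + q_pow (- 1)"
  let ?e = "idem x * edge i * idem z"
  have "idem x * (edge i * edge i) * idem z = (idem x * edge i) * (edge i * idem z)"
    by (simp add: mult.assoc)
  also have "\<dots> \<approx> (\<Sum>y\<in>D. (idem x * edge i) * idem y * (edge i * idem z))"
    by (intro cong_insert_idem free_carrier_mult cl)
  also have "\<dots> \<approx> scale ?c ?e"
  proof (cases "act x i \<in> D \<and> z \<in> {x, act x i}")
    case True
    then have xi: "act x i \<in> D" and zx: "z \<in> {x, act x i}" by auto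
    let ?g = "\<lambda>y. scale (q_pow (int (l (act y i)) - int (l y))) ?e"
    have "(\<Sum>y\<in>D. (idem x * edge i) * idem y * (edge i * idem z)) \<approx> sum ?g {x, act x i}"
    proof (rule cong_sum_support[OF fin])
      fix y assume y: "y \<in> {x, act x i}"
      then have "y \<in> D" "act y i \<in> D" "x \<in> {y, act y i}" "z \<in> {y, act y i}"
        using x xi zx act_act[OF i x] by auto
      from square_relation[OF i this]
      show "(idem x * edge i) * idem y * (edge i * idem z) \<approx> ?g y"
        by (simp add: mult.assoc)
    next
      fix y assume "y \<in> D - {x, act x i}"
      then have "idem x * edge i * idem y \<approx> 0"
        using x i by (intro idem_edge_idem_zero) auto
      from cong_mult[OF this cong_refl, of "edge i * idem z"] cl
      show "(idem x * edge i) * idem y * (edge i * idem z) \<approx> 0"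
        by (simp add: free_carrier_mult)
    qed (use x xi in auto)
    moreover have "sum ?g {x, act x i} = scale ?c ?e"
      using length_act[OF i x] act_act[OF i x] act_neq[OF i x]
      by (auto simp: scale_add add.commute)
    ultimately show ?thesis by simp
  next
    case False
    then have "?e \<approx> 0" using x z i by (intro idem_edge_idem_zero) auto
    from cong_sym[OF cong_scale[OF this, of ?c]] have e0: "0 \<approx> scale ?c ?e"
      by (simp add: scale_zero)
    have "(\<Sum>y\<in>D. (idem x * edge i) * idem y * (edge i * idem z)) \<approx> (\<Sum>y\<in>D. 0)"
    proof (rule cong_sum)
      fix y assume y: "y \<in> D"
      consider "act x i \<notin> D \<or> y \<notin> {x, act x i}" | "act y i \<notin> D \<or> z \<notin> {y, act y i}"
        using False act_act[OF i x] by auto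
      then show "(idem x * edge i) * idem y * (edge i * idem z) \<approx> 0"
      proof cases
        case 1
        from cong_mult[OF idem_edge_idem_zero[OF x y i 1] cong_refl, of "edge i * idem z"] cl
        show ?thesis by (simp add: free_carrier_mult)
      next
        case 2
        from cong_mult[OF cong_refl idem_edge_idem_zero[OF y z i 2], of "idem x * edge i"] cl
        show ?thesis by (simp add: free_carrier_mult mult.assoc)
      qed
    qed
    also have "(\<Sum>y\<in>D. 0) \<approx> scale ?c ?e" using e0 by simp
    finally show ?thesis .
  qed
  finally show "idem x * (edge i * edge i) * idem z \<approx> idem x * scale ?c (edge i) * idem z"
    by (simp add: mult_scale scale_mult)
qed (use i in \<open>auto simp: oriented_gens_def intro!: free_carrier_intros\<close>)

text \<open>
  In the component between \<open>x\<close> and \<open>z\<close> of \<open>E\<^sub>i E\<^sub>j E\<^sub>i\<close>, insert idempotents \<open>y\<close> and \<open>y'\<close> on both sides of \<open>E\<^sub>j\<close>.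
  The first \<open>E\<^sub>i\<close> forces \<open>y \<in> {x, xs\<^sub>i}\<close> and \<open>E\<^sub>j\<close> forces \<open>y' \<in> {y, ys\<^sub>j}\<close>. For \<open>y' = ys\<^sub>j\<close> the last \<open>E\<^sub>i\<close>
  vanishes, because \<open>y's\<^sub>i\<close> is not in \<open>D\<close>. The two terms with \<open>y' = y\<close> are given by the
  relation at the double bond.
\<close>

lemma edge_double_bond:
  assumes i: "i \<in> I" and j: "j \<in> I" and m: "m i j = 4" and short: "short i"
  shows "edge i * edge j * edge i \<approx> edge i + edge i"
proof (rule cong_peirce)
  fix x z assume fin: "finite D" and x: "x \<in> D" and z: "z \<in> D"
  note cl = idem_closed[OF x] idem_closed[OF z] edge_closed[OF i] edge_closed[OF j]
  let ?e = "idem x * edge i * idem z"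
  let ?L = "\<lambda>y. idem x * edge i * idem y" and ?R = "\<lambda>y. idem y * edge i * idem z"
  let ?t = "\<lambda>y y'. idem x * edge i * idem y * edge j * idem y' * edge i * idem z"
  have L0: "?t y y' \<approx> 0" if y: "y \<in> D" "y' \<in> D" "act x i \<notin> D \<or> y \<notin> {x, act x i}" for y y'
    using cong_mult[OF idem_edge_idem_zero[OF x y(1) i y(3)] cong_refl,
        of "edge j * idem y' * edge i * idem z"] cl idem_closed[OF y(2)]
    by (simp add: free_carrier_mult mult.assoc)
  have R0: "?t y y' \<approx> 0" if y: "y \<in> D" "y' \<in> D" "act y' i \<notin> D \<or> z \<notin> {y', act y' i}" for y y'
    using cong_mult[OF cong_refl idem_edge_idem_zero[OF y(2) z i y(3)],
        of "idem x * edge i * idem y * edge j"] cl idem_closed[OF y(1)]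
    by (simp add: free_carrier_mult mult.assoc)
  have M0: "?t y y' \<approx> 0" if y: "y \<in> D" "y' \<in> D" "act y j \<notin> D \<or> y' \<notin> {y, act y j}" for y y'
    using cong_mult[OF cong_mult[OF cong_refl idem_edge_idem_zero[OF y(1,2) j y(3)]] cong_refl,
        of "idem x * edge i" "edge i * idem z"] cl
    by (simp add: free_carrier_mult mult.assoc)
  \<comment> \<open>The terms in which \<open>E\<^sub>j\<close> changes the idempotent.\<close>
  have off: "?t y y' \<approx> 0" if y: "y \<in> D" "y' \<in> D" "y' \<noteq> y" for y y'
  proof (cases "act x i \<in> D \<and> y \<in> {x, act x i} \<and> y' = act y j")
    case True
    then have "act y i \<in> D" using x act_act[OF i x] by auto
    then have "act y' i \<notin> D" using double_bond[OF i j m short y(1)] True by simp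
    then show ?thesis using R0[OF y(1,2)] by blast
  next
    case False
    then show ?thesis using L0[OF y(1,2)] M0[OF y(1,2)] y(3) by blast
  qed
  have "idem x * (edge i * edge j * edge i) * idem z =
      (idem x * edge i) * (edge j * edge i * idem z)"
    by (simp add: mult.assoc)
  also have "\<dots> \<approx> (\<Sum>y\<in>D. (idem x * edge i) * idem y * (edge j * edge i * idem z))"
    by (intro cong_insert_idem free_carrier_mult cl)
  also have "\<dots> = (\<Sum>y\<in>D. (idem x * edge i * idem y * edge j) * (edge i * idem z))"
    by (simp add: mult.assoc)
  also have "\<dots> \<approx> (\<Sum>y\<in>D. \<Sum>y'\<in>D.
      (idem x * edge i * idem y * edge j) * idem y' * (edge i * idem z))"
    by (intro cong_sum cong_insert_idem free_carrier_mult cl idem_closed)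
  also have "\<dots> = (\<Sum>y\<in>D. \<Sum>y'\<in>D. ?t y y')"
    by (simp add: mult.assoc)
  also have "\<dots> \<approx> (\<Sum>y\<in>D. \<Sum>y'\<in>{y}. ?t y y')"
    using off
    by (intro cong_sum cong_sum_support[OF fin] cong_refl free_carrier_mult cl idem_closed) auto
  also have "\<dots> = (\<Sum>y\<in>D. ?t y y)" by simp
  also have "\<dots> \<approx> ?e + ?e"
  proof (cases "act x i \<in> D \<and> z \<in> {x, act x i}")
    case True
    then have xi: "act x i \<in> D" and zx: "z \<in> {x, act x i}" by auto
    have "(\<Sum>y\<in>D. ?t y y) \<approx> (\<Sum>y\<in>{x, act x i}. ?e)"
    proof (rule cong_sum_support[OF fin])
      fix y assume y: "y \<in> {x, act x i}"
      then have "y \<in> D" "act y i \<in> D" "x \<in> {y, act y i}" "z \<in> {y, act y i}"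
        using x xi zx act_act[OF i x] by auto
      then show "?t y y \<approx> ?e"
        using double_bond_relation[OF i j m short] double_bond[OF i j m short] by blast
    next
      fix y assume "y \<in> D - {x, act x i}"
      then show "?t y y \<approx> 0" using L0 by blast
    qed (use x xi in auto)
    also have "(\<Sum>y\<in>{x, act x i}. ?e) = ?e + ?e"
      using act_neq[OF i x] by (simp add: mult_2)
    finally show ?thesis .
  next
    case False
    then have "?e \<approx> 0" using x z i by (intro idem_edge_idem_zero) auto
    from cong_sym[OF cong_add[OF this this]] have e0: "0 \<approx> ?e + ?e" by simp
    have "(\<Sum>y\<in>D. ?t y y) \<approx> (\<Sum>y\<in>D. 0)"
    proof (rule cong_sum)
      fix y assume y: "y \<in> D"
      show "?t y y \<approx> 0"
        using False act_act[OF i x] L0[OF y y] R0[OF y y] by auto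
    qed
    also have "(\<Sum>y\<in>D. 0) \<approx> ?e + ?e" using e0 by simp
    finally show ?thesis .
  qed
  finally show "idem x * (edge i * edge j * edge i) * idem z \<approx> idem x * (edge i + edge i) * idem z"
    by (simp add: distrib_left distrib_right)
qed (use i j in \<open>auto simp: oriented_gens_def intro!: free_carrier_intros\<close>)

text \<open>
  One of \<open>\<alpha>\<^sub>i\<close>, \<open>\<alpha>\<^sub>j\<close> is short, so either the first three or the last three factors collapse.
\<close>

lemma edge_quartic:
  assumes i: "i \<in> I" and j: "j \<in> I" and m: "m i j = 4"
  shows "edge i * edge j * edge i * edge j \<approx> scale 2 (edge i * edge j)"
proof -
  note cl = edge_closed[OF i] edge_closed[OF j]
  from short_or[OF i j m] consider "short i" | "short j" "m j i = 4" by blast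
  then show ?thesis
  proof cases
    case 1
    from cong_mult[OF edge_double_bond[OF i j m 1] cong_refl[OF cl(2)]]
    show ?thesis by (simp add: scale_two distrib_right)
  next
    case 2
    from cong_mult[OF cong_refl[OF cl(1)] edge_double_bond[OF j i 2(2,1)]]
    show ?thesis by (simp add: scale_two distrib_left mult.assoc)
  qed
qed

lemma edges_satisfy_TL_relations:
  assumes "(a, b) \<in> TL_relations I m"
  shows "relabel Edge a \<approx> relabel Edge b"
  using assms unfolding TL_relations_def
  by (elim UnE)
     (auto simp: relabel_mult relabel_gen relabel_scale edge_square edge_quartic
        edge_commute edge_braid)

end

lemma TL_presentation: "algebra_presentation I (TL_relations I m)"
  by standard (auto simp: TL_relations_def intro!: free_carrier_intros)

lemma oriented_presentation_hermitian:
  fixes W (structure)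
  assumes cox: "coxeter_system W (nodes T) s (coxeter_matrix T)" and pair: "hermitian_pair T k"
  shows "oriented_presentation (nodes T) (coxeter_matrix T) (short_root T) (oriented_reps W s T k)
    (cox_length W (nodes T) s) (\<lambda>w i. w \<otimes> s i)"
proof -
  interpret coxeter_system W "nodes T" s "coxeter_matrix T" by (rule cox)
  have carr: "w \<in> carrier W" if "w \<in> oriented_reps W s T k" for w
    using that by (simp add: oriented_reps_def min_coset_reps_iff)
  show ?thesis
  proof
    fix i j assume ij: "i \<in> nodes T" "j \<in> nodes T" "coxeter_matrix T i j = 4"
    then have e: "{i, j} \<in> double_edges T"
      by (simp add: coxeter_matrix_def split: if_splits)
    have "short_root T i \<or> short_root T j"
      using e pair by (cases T) (auto simp: doubleton_eq_iff)
    then show "coxeter_matrix T j i = 4 \<and> (short_root T i \<or> short_root T j)"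
      using m_sym[OF ij(1,2)] ij(3) by simp
  next
    fix i j w
    assume "coxeter_matrix T i j = 4" "short_root T i" "w \<in> oriented_reps W s T k"
      "w \<otimes> s i \<in> oriented_reps W s T k"
    then show "w \<otimes> s j \<in> oriented_reps W s T k \<and> w \<otimes> s j \<otimes> s i \<notin> oriented_reps W s T k"
      using double_bond_min_coset_reps[OF cox pair] by blast
  qed (use carr s_cancel len_mult_s in auto)
qed

theorem proposition3p14:
  fixes W :: "('w, 'b) monoid_scheme" and s :: "nat \<Rightarrow> 'w"
    and T :: cartan_type and k :: nat
  assumes "coxeter_system W (nodes T) s (coxeter_matrix T)"
    and "hermitian_pair T k"
  shows "\<exists>h \<in> algebra_hom (TL T) (oriented_TL W s T k).
           \<forall>i\<in>nodes T. h (TL_U T i) = oriented_TL_E W s T k i"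
proof -
  interpret oriented_presentation "nodes T" "coxeter_matrix T" "short_root T"
    "oriented_reps W s T k" "cox_length W (nodes T) s" "\<lambda>w i. w \<otimes>\<^bsub>W\<^esub> s i"
    using oriented_presentation_hermitian[OF assms] .
  show ?thesis
    unfolding TL_def TL_U_def oriented_TL_def oriented_TL_E_def oriented_TL_rels_def
  proof (rule presented_algebra_hom[OF TL_presentation algebra_presentation_axioms])
    show "Edge ` nodes T \<subseteq> oriented_gens (nodes T) (oriented_reps W s T k)"
      by (simp add: oriented_gens_def)
  qed (rule edges_satisfy_TL_relations)
qed

end
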